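(* Let $E$ be a finite set and $\Omega=E^{\mathbb{Z}}$ with left shift $S$. Let $\mu$ be a shift-invariant probability measure on $\Omega$ which is a DLR Gibbs measure (i.e. Gibbs for some Gibbsian specification on $\Omega$). Then there exists a continuous function $\phi:\Omega\to\mathbb{R}$ with the extensibility property such that $\mu$ is an equilibrium state for $\phi$.
   Context: $E$ is finite with the discrete topology, $\Omega=E^{\mathbb{Z}}$ has the product topology, $(S\omega)_i=\omega_{i+1}$. For $\omega\in\Omega$, $a\in E$, $\omega^a$ is the configuration equal to $a$ at site $0$ and to $\omega_k$ at $k\ne0$. A continuous $\phi$ has the extensibility property if for all $a,\tilde a\in E$, $\sum_{i=-n}^{n}[\phi(S^i\omega^a)-\phi(S^i\omega^{\tilde a})]$ converges uniformly in $\omega$ as $n\to\infty$. An equilibrium state for $\phi$ is a shift-invariant probability $\mu$ with $h(\mu)+\int\phi\,d\mu=P(\phi)$ (measure-theoretic entropy, topological pressure). For finite $\Lambda\subset\mathbb{Z}$, $\xi_\Lambda\omega_{\Lambda^c}$ denotes the configuration equal to $\xi$ on $\Lambda$ and $\omega$ elsewhere. A specification is a family $(\gamma_\Lambda)_{\Lambda\text{ finite}}$ of probabilities $\gamma_\Lambda(\cdot|\omega_{\Lambda^c})$ on $E^\Lambda$ depending only on $\omega_{\Lambda^c}$, consistent in the sense that with $\gamma_\Lambda(f|\omega)=\sum_{\xi_\Lambda}\gamma_\Lambda(\xi_\Lambda|\omega_{\Lambda^c})f(\xi_\Lambda\omega_{\Lambda^c})$, for finite $\Delta\subset\Lambda$: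 $\sum_{\xi_\Lambda}\gamma_\Lambda(\xi_\Lambda|\omega_{\Lambda^c})\gamma_\Delta(f|\xi_\Lambda\omega_{\Lambda^c})=\gamma_\Lambda(f|\omega)$. It is Gibbsian if non-null ($\inf_\omega\gamma_\Lambda(\omega_\Lambda|\omega_{\Lambda^c})>0$) and continuous ($\omega\mapsto\gamma_\Lambda(\omega_\Lambda|\omega_{\Lambda^c})$ continuous) for every finite $\Lambda$. $\mu$ is Gibbs for $\gamma$ if $\int\gamma_\Lambda(f|\omega)\mu(d\omega)=\int f\,d\mu$ for all $f\in C(\Omega)$ and finite $\Lambda$. *)

theory Defs
  imports "HOL-Probability.Probability"
begin

definition Omega_top :: "(int \<Rightarrow> 'e) topology" where
  "Omega_top = product_topology (\<lambda>_. discrete_topology UNIV) UNIV"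

text \<open>Measurable structure: the product sigma-algebra (= Borel sigma-algebra of Omega_top).\<close>
definition Omega_M :: "(int \<Rightarrow> 'e) measure" where
  "Omega_M = Pi\<^sub>M UNIV (\<lambda>_. count_space UNIV)"

definition shiftZ :: "int \<Rightarrow> (int \<Rightarrow> 'e) \<Rightarrow> (int \<Rightarrow> 'e)" where
  "shiftZ i \<omega> = (\<lambda>k. \<omega> (k + i))"

definition shift :: "(int \<Rightarrow> 'e) \<Rightarrow> (int \<Rightarrow> 'e)" where
  "shift = shiftZ 1"

definition glue :: "int set \<Rightarrow> (int \<Rightarrow> 'e) \<Rightarrow> (int \<Rightarrow> 'e) \<Rightarrow> (int \<Rightarrow> 'e)" where
  "glue \<Lambda> \<xi> \<omega> = (\<lambda>k. if k \<in> \<Lambda> then \<xi> k else \<omega> k)"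

abbreviation local_configs :: "int set \<Rightarrow> (int \<Rightarrow> 'e) set" where
  "local_configs \<Lambda> \<equiv> PiE \<Lambda> (\<lambda>_. UNIV)"

definition shift_invariant_prob :: "(int \<Rightarrow> 'e) measure \<Rightarrow> bool" where
  "shift_invariant_prob M \<longleftrightarrow> prob_space M \<and> sets M = sets Omega_M \<and>
     (\<forall>A \<in> sets M. measure M (shift -` A \<inter> space M) = measure M A)"

definition is_fin_partition :: "'a measure \<Rightarrow> (nat \<Rightarrow> 'a set) \<Rightarrow> nat \<Rightarrow> bool" where
  "is_fin_partition M \<alpha> k \<longleftrightarrow> (\<forall>i<k. \<alpha> i \<in> sets M) \<and>
     (\<forall>i<k. \<forall>j<k. i \<noteq> j \<longrightarrow> \<alpha> i \<inter> \<alpha> j = {}) \<and> (\<Union>i<k. \<alpha> i) = space M"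

text \<open>Entropy of the refinement alpha v S^-1 alpha v ... v S^-(n-1) alpha (with 0 ln 0 = 0).\<close>
definition join_entropy :: "(int \<Rightarrow> 'e) measure \<Rightarrow> (nat \<Rightarrow> (int \<Rightarrow> 'e) set) \<Rightarrow> nat \<Rightarrow> nat \<Rightarrow> real" where
  "join_entropy M \<alpha> k n =
     - (\<Sum>w \<in> PiE {..<n} (\<lambda>_. {..<k}).
          let C = space M \<inter> (\<Inter>j<n. shiftZ (int j) -` \<alpha> (w j))
          in measure M C * ln (measure M C))"

definition partition_entropy :: "(int \<Rightarrow> 'e) measure \<Rightarrow> (nat \<Rightarrow> (int \<Rightarrow> 'e) set) \<Rightarrow> nat \<Rightarrow> real" where
  "partition_entropy M \<alpha> k = lim (\<lambda>n. join_entropy M \<alpha> k (Suc n) / real (Suc n))"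

definition ks_entropy :: "(int \<Rightarrow> 'e) measure \<Rightarrow> real" where
  "ks_entropy M = Sup {partition_entropy M \<alpha> k | \<alpha> k. is_fin_partition M \<alpha> k}"

definition birkhoff_sum :: "((int \<Rightarrow> 'e) \<Rightarrow> real) \<Rightarrow> nat \<Rightarrow> (int \<Rightarrow> 'e) \<Rightarrow> real" where
  "birkhoff_sum \<phi> n \<omega> = (\<Sum>j<n. \<phi> (shiftZ (int j) \<omega>))"

definition partition_fn :: "((int \<Rightarrow> 'e) \<Rightarrow> real) \<Rightarrow> nat \<Rightarrow> real" where
  "partition_fn \<phi> n = (\<Sum>w \<in> local_configs {0..<int n}.
      exp (Sup {birkhoff_sum \<phi> n \<omega> | \<omega>. \<forall>k \<in> {0..<int n}. \<omega> k = w k}))"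

definition pressure :: "((int \<Rightarrow> 'e) \<Rightarrow> real) \<Rightarrow> real" where
  "pressure \<phi> = lim (\<lambda>n. ln (partition_fn \<phi> (Suc n)) / real (Suc n))"

definition equilibrium_state :: "((int \<Rightarrow> 'e) \<Rightarrow> real) \<Rightarrow> (int \<Rightarrow> 'e) measure \<Rightarrow> bool" where
  "equilibrium_state \<phi> M \<longleftrightarrow> shift_invariant_prob M \<and>
     ks_entropy M + integral\<^sup>L M \<phi> = pressure \<phi>"

definition extensible :: "((int \<Rightarrow> 'e) \<Rightarrow> real) \<Rightarrow> bool" where
  "extensible \<phi> \<longleftrightarrow> (\<forall>a b :: 'e. uniformly_convergent_on UNIV
      (\<lambda>n \<omega>. \<Sum>i \<in> {-int n..int n}. \<phi> (shiftZ i (fun_upd \<omega> 0 a)) - \<phi> (shiftZ i (fun_upd \<omega> 0 b))))"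

text \<open>gamma Lambda xi omega = gamma_Lambda(xi_Lambda | omega_(Lambda^c)), for xi in local_configs Lambda.\<close>

definition spec_expect :: "(int set \<Rightarrow> (int \<Rightarrow> 'e) \<Rightarrow> (int \<Rightarrow> 'e) \<Rightarrow> real) \<Rightarrow> int set
     \<Rightarrow> ((int \<Rightarrow> 'e) \<Rightarrow> real) \<Rightarrow> (int \<Rightarrow> 'e) \<Rightarrow> real" where
  "spec_expect \<gamma> \<Lambda> f \<omega> = (\<Sum>\<xi> \<in> local_configs \<Lambda>. \<gamma> \<Lambda> \<xi> \<omega> * f (glue \<Lambda> \<xi> \<omega>))"

definition is_specification :: "(int set \<Rightarrow> (int \<Rightarrow> 'e) \<Rightarrow> (int \<Rightarrow> 'e) \<Rightarrow> real) \<Rightarrow> bool" where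
  "is_specification \<gamma> \<longleftrightarrow>
     (\<forall>\<Lambda> \<xi> \<omega>. finite \<Lambda> \<longrightarrow> \<xi> \<in> local_configs \<Lambda> \<longrightarrow> \<gamma> \<Lambda> \<xi> \<omega> \<ge> 0) \<and>
     (\<forall>\<Lambda> \<omega>. finite \<Lambda> \<longrightarrow> (\<Sum>\<xi> \<in> local_configs \<Lambda>. \<gamma> \<Lambda> \<xi> \<omega>) = 1) \<and>
     (\<forall>\<Lambda> \<xi> \<omega> \<omega>'. finite \<Lambda> \<longrightarrow> \<xi> \<in> local_configs \<Lambda> \<longrightarrow> (\<forall>k. k \<notin> \<Lambda> \<longrightarrow> \<omega> k = \<omega>' k)
        \<longrightarrow> \<gamma> \<Lambda> \<xi> \<omega> = \<gamma> \<Lambda> \<xi> \<omega>') \<and>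
     (\<forall>\<Lambda> \<Delta> f \<omega>. finite \<Lambda> \<longrightarrow> \<Delta> \<subseteq> \<Lambda> \<longrightarrow>
        (\<Sum>\<xi> \<in> local_configs \<Lambda>. \<gamma> \<Lambda> \<xi> \<omega> * spec_expect \<gamma> \<Delta> f (glue \<Lambda> \<xi> \<omega>))
          = spec_expect \<gamma> \<Lambda> f \<omega>)"

definition gibbsian :: "(int set \<Rightarrow> (int \<Rightarrow> 'e) \<Rightarrow> (int \<Rightarrow> 'e) \<Rightarrow> real) \<Rightarrow> bool" where
  "gibbsian \<gamma> \<longleftrightarrow> is_specification \<gamma> \<and>
     (\<forall>\<Lambda>. finite \<Lambda> \<longrightarrow> (\<exists>c>0. \<forall>\<omega>. \<gamma> \<Lambda> (restrict \<omega> \<Lambda>) \<omega> \<ge> c)) \<and>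
     (\<forall>\<Lambda>. finite \<Lambda> \<longrightarrow> continuous_map Omega_top euclideanreal (\<lambda>\<omega>. \<gamma> \<Lambda> (restrict \<omega> \<Lambda>) \<omega>))"

definition gibbs_for :: "(int set \<Rightarrow> (int \<Rightarrow> 'e) \<Rightarrow> (int \<Rightarrow> 'e) \<Rightarrow> real) \<Rightarrow> (int \<Rightarrow> 'e) measure \<Rightarrow> bool" where
  "gibbs_for \<gamma> M \<longleftrightarrow> (\<forall>\<Lambda> f. finite \<Lambda> \<longrightarrow> continuous_map Omega_top euclideanreal f \<longrightarrow>
      (\<integral>\<omega>. spec_expect \<gamma> \<Lambda> f \<omega> \<partial>M) = (\<integral>\<omega>. f \<omega> \<partial>M))"

end

theory Submission
  imports Defs "HOL-Real_Asymp.Real_Asymp"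
begin

text \<open>
  By non-nullness \<open>M\<close> has full support, so the continuous single-site kernels of \<open>\<gamma>\<close> are determined
  by \<open>M\<close> and inherit its shift invariance. Fix a letter \<open>t\<close> and let \<open>\<phi>(\<omega>)\<close> be the logarithm of the ratio
  \<open>\<gamma>\<^sub>0(\<omega>\<^sub>0 | \<dots>) / \<gamma>\<^sub>0(t | \<dots>)\<close> given \<open>\<omega>\<close> to the left of \<open>0\<close> and constantly \<open>t\<close> to its right. Sums of
  \<open>\<phi>\<close> along the shift telescope into a log ratio of the kernel of the whole window. Changing \<open>\<omega>\<close> at site
  \<open>0\<close> therefore changes the sum over \<open>[-n, n]\<close> by a single-site log ratio with boundary condition \<open>t\<close>
  beyond \<open>n\<close>, which converges uniformly: this is extensibility. The same telescoping shows that
  \<open>ln M[\<omega>\<^sub>0 \<dots> \<omega>\<^sub>n\<^sub>-\<^sub>1] = S\<^sub>n\<phi>(\<omega>) - ln Z\<^sub>n + o(n)\<close> uniformly in \<open>\<omega>\<close>; integrating, the entropy of words of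
  length \<open>n\<close> is \<open>ln Z\<^sub>n - n \<integral>\<phi> dM + o(n)\<close>. Dividing by \<open>n\<close> and using that the partition into letters is
  generating (Kolmogorov--Sinai) yields \<open>h(M) + \<integral>\<phi> dM = P(\<phi>)\<close>, with no appeal to the variational
  principle.
\<close>

section \<open>Continuity on the configuration space\<close>

definition agree :: "nat \<Rightarrow> (int \<Rightarrow> 'e) \<Rightarrow> (int \<Rightarrow> 'e) \<Rightarrow> bool" where
  "agree m \<omega> \<omega>' \<longleftrightarrow> (\<forall>k. \<bar>k\<bar> \<le> int m \<longrightarrow> \<omega> k = \<omega>' k)"

text \<open>Uniform continuity for the windows [-m, m]. Over a finite alphabet compactness makes it
  equivalent to continuity for \<open>Omega_top\<close>, and it hands every later estimate a window
  size that does not depend on the configuration.\<close>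

definition ucont :: "((int \<Rightarrow> 'e) \<Rightarrow> real) \<Rightarrow> bool" where
  "ucont f \<longleftrightarrow> (\<forall>\<epsilon>>0. \<exists>m. \<forall>\<omega> \<omega>'. agree m \<omega> \<omega>' \<longrightarrow> \<bar>f \<omega> - f \<omega>'\<bar> < \<epsilon>)"

lemma agree_refl [simp]: "agree m \<omega> \<omega>"
  by (simp add: agree_def)

lemma agree_mono: "agree n \<omega> \<omega>' \<Longrightarrow> m \<le> n \<Longrightarrow> agree m \<omega> \<omega>'"
  by (simp add: agree_def)

lemma agree_restrict [simp]: "agree m \<omega> (restrict \<omega> {-int m..int m})"
  by (simp add: agree_def abs_le_iff)

lemma restrict_eq_if_agree: "agree m \<omega> \<omega>' \<Longrightarrow> restrict \<omega> {-int m..int m} = restrict \<omega>' {-int m..int m}"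
  by (rule restrict_ext) (simp add: agree_def abs_le_iff)

lemma finite_int_set_bounded:
  assumes "finite (F :: int set)" shows "\<exists>m. \<forall>k\<in>F. \<bar>k\<bar> \<le> int m"
proof (intro exI ballI)
  fix k assume "k \<in> F"
  then have "\<bar>k\<bar> \<le> Max (abs ` F)" using assms by simp
  then show "\<bar>k\<bar> \<le> int (nat (Max (abs ` F)))" by linarith
qed

lemma topspace_Omega_top [simp]: "topspace Omega_top = UNIV"
  by (simp add: Omega_top_def)

text \<open>A basic open set of the product constrains finitely many coordinates, all of which lie
  in one window [-m, m]; hence the centred cylinders form a neighbourhood base.\<close>

lemma openin_Omega_top_iff:
  "openin Omega_top U \<longleftrightarrow> (\<forall>x\<in>U. \<exists>m. \<forall>y. agree m x y \<longrightarrow> y \<in> U)"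
proof
  assume "openin Omega_top U"
  show "\<forall>x\<in>U. \<exists>m. \<forall>y. agree m x y \<longrightarrow> y \<in> U"
  proof
    fix x assume "x \<in> U"
    then obtain V where V: "finite {i. V i \<noteq> UNIV}" "x \<in> Pi\<^sub>E UNIV V" "Pi\<^sub>E UNIV V \<subseteq> U"
      using \<open>openin Omega_top U\<close>
      unfolding Omega_top_def openin_product_topology_alt by force
    obtain m where m: "\<forall>k\<in>{i. V i \<noteq> UNIV}. \<bar>k\<bar> \<le> int m"
      using finite_int_set_bounded[OF V(1)] by (elim exE)
    have "y \<in> U" if "agree m x y" for y
    proof -
      have "y k \<in> V k" for k
      proof (cases "V k = UNIV")
        case False
        then have "x k = y k" using m that by (simp add: agree_def)
        then show ?thesis using PiE_mem[OF V(2), of k] by simp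
      qed simp
      then show ?thesis using V(3) by auto
    qed
    then show "\<exists>m. \<forall>y. agree m x y \<longrightarrow> y \<in> U" by blast
  qed
next
  assume R: "\<forall>x\<in>U. \<exists>m. \<forall>y. agree m x y \<longrightarrow> y \<in> U"
  show "openin Omega_top U"
    unfolding Omega_top_def openin_product_topology_alt
  proof
    fix x assume "x \<in> U"
    then obtain m where m: "\<And>y. agree m x y \<Longrightarrow> y \<in> U" using R by blast
    define V where "V = (\<lambda>k. if \<bar>k\<bar> \<le> int m then {x k} else UNIV)"
    have "{i. V i \<noteq> UNIV} \<subseteq> {-int m..int m}"
      by (auto simp: V_def split: if_splits)
    then have "finite {i. V i \<noteq> UNIV}" by (rule finite_subset) simp
    moreover have "Pi\<^sub>E UNIV V \<subseteq> U"
    proof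
      fix y assume y: "y \<in> Pi\<^sub>E UNIV V"
      have "x k = y k" if "\<bar>k\<bar> \<le> int m" for k
        using PiE_mem[OF y, of k] that by (simp add: V_def)
      then show "y \<in> U" by (intro m) (simp add: agree_def)
    qed
    moreover have "x \<in> Pi\<^sub>E UNIV V" by (auto simp: V_def)
    ultimately show "\<exists>U'. finite {i \<in> UNIV. U' i \<noteq> topspace (discrete_topology UNIV)} \<and>
        (\<forall>i\<in>UNIV. openin (discrete_topology UNIV) (U' i)) \<and> x \<in> Pi\<^sub>E UNIV U' \<and> Pi\<^sub>E UNIV U' \<subseteq> U"
      by (intro exI[of _ V]) simp
  qed
qed

lemma compact_space_Omega_top: "compact_space (Omega_top :: (int \<Rightarrow> 'e::finite) topology)"
  by (simp add: Omega_top_def compact_space_product_topology compact_space_discrete_topology)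

lemma ucont_imp_continuous:
  assumes "ucont f" shows "continuous_map Omega_top euclideanreal f"
proof -
  have "openin Omega_top {x. f x \<in> U}" if "open U" for U
    unfolding openin_Omega_top_iff
  proof
    fix x assume "x \<in> {x. f x \<in> U}"
    then obtain e where e: "e > 0" "\<And>y. dist y (f x) < e \<Longrightarrow> y \<in> U"
      using \<open>open U\<close> by (auto simp: open_dist)
    obtain m where "\<And>y. agree m x y \<Longrightarrow> \<bar>f x - f y\<bar> < e"
      using assms e(1) unfolding ucont_def by blast
    then show "\<exists>m. \<forall>y. agree m x y \<longrightarrow> y \<in> {x. f x \<in> U}"
      using e(2) by (auto simp: dist_real_def abs_minus_commute)
  qed
  then show ?thesis by (simp add: continuous_map_def)
qed

text \<open>Heine--Cantor. Cylinders on which \<open>f\<close> varies little cover the compact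
  space, and \<open>N\<close> bounds the windows of a finite subcover. Agreement on a window is an
  equivalence relation, so two points that agree on [-N, N] lie in a common cylinder of the
  subcover.\<close>

lemma continuous_imp_ucont:
  fixes f :: "(int \<Rightarrow> 'e::finite) \<Rightarrow> real"
  assumes "continuous_map Omega_top euclideanreal f" shows "ucont f"
  unfolding ucont_def
proof (intro allI impI)
  fix \<epsilon> :: real assume "\<epsilon> > 0"
  have "\<exists>m. \<forall>y. agree m x y \<longrightarrow> y \<in> {y. f y \<in> ball (f x) (\<epsilon>/2)}" for x
  proof -
    have "openin Omega_top {y. f y \<in> ball (f x) (\<epsilon>/2)}"
      using assms unfolding continuous_map_def by (simp del: mem_ball)
    then show ?thesis
      unfolding openin_Omega_top_iff using \<open>\<epsilon> > 0\<close> by simp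
  qed
  then obtain m where m: "\<And>x y. agree (m x) x y \<Longrightarrow> \<bar>f x - f y\<bar> < \<epsilon>/2"
    unfolding mem_Collect_eq mem_ball dist_real_def by metis
  let ?C = "\<lambda>x. {y. agree (m x) x y}"
  have op: "openin Omega_top (?C x)" for x
    unfolding openin_Omega_top_iff by (auto simp: agree_def)
  have "UNIV \<subseteq> \<Union>(range ?C)" by (auto intro: agree_refl)
  with op obtain \<F> where F: "finite \<F>" "\<F> \<subseteq> range ?C" "UNIV \<subseteq> \<Union>\<F>"
    using compact_space_Omega_top unfolding compact_space_alt topspace_Omega_top
    by (metis (no_types, lifting) rangeE)
  then obtain X where X: "finite X" "\<F> = ?C ` X" by (meson finite_subset_image)
  obtain N where N: "\<And>x. x \<in> X \<Longrightarrow> m x \<le> N"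
    using X(1) by (metis Max_ge finite_imageI imageI)
  have "\<bar>f y - f z\<bar> < \<epsilon>" if "agree N y z" for y z
  proof -
    obtain x where x: "x \<in> X" "agree (m x) x y" using F(3) X(2) by auto
    then have "agree (m x) x z"
      using agree_mono[OF that N[OF x(1)]] by (simp add: agree_def)
    then show ?thesis using m[of x z] m[of x y] x by linarith
  qed
  then show "\<exists>m. \<forall>\<omega> \<omega>'. agree m \<omega> \<omega>' \<longrightarrow> \<bar>f \<omega> - f \<omega>'\<bar> < \<epsilon>" by blast
qed

lemma continuous_iff_ucont:
  "continuous_map Omega_top euclideanreal (f :: (int \<Rightarrow> 'e::finite) \<Rightarrow> real) \<longleftrightarrow> ucont f"
  using continuous_imp_ucont ucont_imp_continuous by blast

lemma ucontD:
  assumes "ucont f" "\<epsilon> > 0"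
  obtains m where "\<And>\<omega> \<omega>'. agree m \<omega> \<omega>' \<Longrightarrow> \<bar>f \<omega> - f \<omega>'\<bar> < \<epsilon>"
  using assms unfolding ucont_def by blast

text \<open>The target type is left open so that the notion covers sets (through their membership
  predicate), real functions and \<open>nat\<close>-valued predictors alike.\<close>

definition local_fun :: "nat \<Rightarrow> ((int \<Rightarrow> 'e) \<Rightarrow> 'b) \<Rightarrow> bool" where
  "local_fun m f \<longleftrightarrow> (\<forall>\<omega> \<omega>'. agree m \<omega> \<omega>' \<longrightarrow> f \<omega> = f \<omega>')"

lemma local_fun_mono: "local_fun m f \<Longrightarrow> m \<le> n \<Longrightarrow> local_fun n f"
  unfolding local_fun_def using agree_mono by blast

lemma local_fun_finite_range:
  fixes f :: "(int \<Rightarrow> 'e::finite) \<Rightarrow> 'b"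
  assumes "local_fun m f" shows "finite (range f)"
proof -
  let ?W = "{-int m..int m}"
  have "f \<omega> = f (restrict \<omega> ?W)" for \<omega>
    using assms agree_restrict unfolding local_fun_def by blast
  then have "range f \<subseteq> f ` local_configs ?W"
    by (metis (no_types, lifting) PiE_I UNIV_I image_iff image_subsetI restrict_PiE_iff)
  then show ?thesis by (rule finite_subset) (simp add: finite_PiE)
qed

text \<open>Up to an error of 1, \<open>f\<close> factors through the restriction to a window, which
  takes finitely many values. The restriction carries \<open>undefined\<close> outside the window
  and is thus again a point of the space.\<close>

lemma ucont_bounded:
  fixes f :: "(int \<Rightarrow> 'e::finite) \<Rightarrow> real"
  assumes "ucont f" obtains B where "B > 0" "\<And>\<omega>. \<bar>f \<omega>\<bar> \<le> B"
proof -
  obtain m where m: "\<And>\<omega> \<omega>'. agree m \<omega> \<omega>' \<Longrightarrow> \<bar>f \<omega> - f \<omega>'\<bar> < 1"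
    using ucontD[OF assms, of 1] by auto
  let ?W = "{-int m..int m}"
  have "local_fun m (\<lambda>\<omega>. f (restrict \<omega> ?W))"
    unfolding local_fun_def by (metis restrict_eq_if_agree)
  then have "finite (range (\<lambda>\<omega>. \<bar>f (restrict \<omega> ?W)\<bar>))"
    using finite_imageI[OF local_fun_finite_range, of m _ abs] by (simp add: image_image)
  then obtain B where B: "\<And>\<omega>. \<bar>f (restrict \<omega> ?W)\<bar> \<le> B"
    by (meson bdd_above.unfold bdd_above_finite rangeI)
  have "\<bar>f \<omega>\<bar> \<le> B + 1" for \<omega>
    using m[OF agree_restrict, of \<omega>] B[of \<omega>] by linarith
  moreover have "B + 1 > 0" using B[of undefined] by linarith
  ultimately show thesis using that by blast
qed

section \<open>Measurability of cylinders, local functions and continuous functions\<close>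

lemma space_Omega_M [simp]: "space (Omega_M :: (int \<Rightarrow> 'e) measure) = UNIV"
  by (simp add: Omega_M_def space_PiM)

lemma measurable_coordinate: "(\<lambda>\<omega>. \<omega> i) \<in> (Omega_M :: (int \<Rightarrow> 'e) measure) \<rightarrow>\<^sub>M count_space UNIV"
  unfolding Omega_M_def by (rule measurable_component_singleton) simp

lemma measurable_cylinder:
  assumes "finite F" shows "{\<omega>. \<forall>k\<in>F. \<omega> k = w k} \<in> sets (Omega_M :: (int \<Rightarrow> 'e) measure)"
proof -
  have "{\<omega> :: int \<Rightarrow> 'e. \<omega> k = w k} \<in> sets Omega_M" for k
    using measurable_sets[OF measurable_coordinate, of "{w k}" k] by (simp add: vimage_def)
  then show ?thesis
    using sets.sets_Collect_finite_All[OF _ assms, of Omega_M "\<lambda>k \<omega>. \<omega> k = w k"] by simp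
qed

lemma local_set_measurable:
  fixes A :: "(int \<Rightarrow> 'e::finite) set"
  assumes "local_fun m (\<lambda>\<omega>. \<omega> \<in> A)" shows "A \<in> sets Omega_M"
proof -
  let ?W = "{-int m..int m}"
  have 1: "\<omega> \<in> A \<longleftrightarrow> restrict \<omega> ?W \<in> A" for \<omega>
    using assms agree_restrict unfolding local_fun_def by blast
  have "A = (\<Union>w \<in> local_configs ?W \<inter> A. {\<omega>. \<forall>k\<in>?W. \<omega> k = w k})"
  proof (intro equalityI subsetI)
    fix \<omega> assume "\<omega> \<in> A"
    then show "\<omega> \<in> (\<Union>w \<in> local_configs ?W \<inter> A. {\<omega>. \<forall>k\<in>?W. \<omega> k = w k})"
      using 1[of \<omega>] by (intro UN_I[of "restrict \<omega> ?W"]) auto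
  next
    fix \<omega> assume "\<omega> \<in> (\<Union>w \<in> local_configs ?W \<inter> A. {\<omega>. \<forall>k\<in>?W. \<omega> k = w k})"
    then obtain w where w: "w \<in> A" "\<forall>k\<in>?W. \<omega> k = w k" by auto
    then have "restrict \<omega> ?W = restrict w ?W" by (auto simp: restrict_def)
    then show "\<omega> \<in> A" using 1[of \<omega>] 1[of w] w(1) by simp
  qed
  also have "\<dots> \<in> sets Omega_M"
    by (intro sets.finite_UN measurable_cylinder) (auto intro!: finite_Int finite_PiE)
  finally show ?thesis .
qed

lemma local_fun_measurable:
  fixes f :: "(int \<Rightarrow> 'e::finite) \<Rightarrow> 'b"
  assumes "local_fun m f" "range f \<subseteq> space N" shows "f \<in> Omega_M \<rightarrow>\<^sub>M N"
proof (rule measurableI)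
  show "f x \<in> space N" for x using assms(2) by auto
  show "f -` A \<inter> space Omega_M \<in> sets Omega_M" for A
    using assms(1) by (intro local_set_measurable[of m]) (auto simp: local_fun_def)
qed

text \<open>Resetting all coordinates outside [-m, m] to \<open>undefined\<close> yields local
  functions that converge pointwise to \<open>f\<close>. This works directly in the product
  sigma-algebra, without passing through Borel sets of the topology.\<close>

lemma ucont_measurable:
  fixes f :: "(int \<Rightarrow> 'e::finite) \<Rightarrow> real"
  assumes "ucont f" shows "f \<in> borel_measurable Omega_M"
proof (rule borel_measurable_LIMSEQ_real)
  let ?f = "\<lambda>m \<omega>. f (restrict \<omega> {-int m..int m})"
  show "?f m \<in> borel_measurable Omega_M" for m
    by (rule local_fun_measurable[of m])
      (auto simp: local_fun_def dest: restrict_eq_if_agree)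
  show "(\<lambda>m. ?f m \<omega>) \<longlonglongrightarrow> f \<omega>" for \<omega>
  proof (rule LIMSEQ_I)
    fix r :: real assume "r > 0"
    then obtain m where m: "\<And>\<omega> \<omega>'. agree m \<omega> \<omega>' \<Longrightarrow> \<bar>f \<omega> - f \<omega>'\<bar> < r"
      using ucontD[OF assms] by blast
    have "norm (?f n \<omega> - f \<omega>) < r" if "n \<ge> m" for n
      unfolding real_norm_def using that by (intro m) (auto simp: agree_def)
    then show "\<exists>no. \<forall>n\<ge>no. norm (?f n \<omega> - f \<omega>) < r" by blast
  qed
qed

section \<open>Closure properties of uniform continuity\<close>

lemma local_fun_ucont: "local_fun m f \<Longrightarrow> ucont f"
  unfolding ucont_def local_fun_def by (intro allI impI exI[of _ m]) auto

text \<open>The second hypothesis is uniform continuity of \<open>T\<close>: each window of the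
  image is determined by a window of the argument. Shifts and gluings are of this kind.\<close>

lemma ucont_compose:
  assumes f: "ucont f"
    and T: "\<And>m. \<exists>n. \<forall>\<omega> \<omega>'. agree n \<omega> \<omega>' \<longrightarrow> agree m (T \<omega>) (T \<omega>')"
  shows "ucont (\<lambda>\<omega>. f (T \<omega>))"
  unfolding ucont_def
proof (intro allI impI)
  fix \<epsilon> :: real assume "\<epsilon> > 0"
  with f obtain m where m: "\<And>\<omega> \<omega>'. agree m \<omega> \<omega>' \<Longrightarrow> \<bar>f \<omega> - f \<omega>'\<bar> < \<epsilon>" by (rule ucontD) blast
  from T[of m] obtain n where "\<And>\<omega> \<omega>'. agree n \<omega> \<omega>' \<Longrightarrow> agree m (T \<omega>) (T \<omega>')" by blast
  with m show "\<exists>m. \<forall>\<omega> \<omega>'. agree m \<omega> \<omega>' \<longrightarrow> \<bar>f (T \<omega>) - f (T \<omega>')\<bar> < \<epsilon>" by blast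
qed

lemma ucont_shiftZ: "ucont f \<Longrightarrow> ucont (\<lambda>\<omega>. f (shiftZ i \<omega>))"
proof (erule ucont_compose)
  show "\<exists>n. \<forall>\<omega> \<omega>'. agree n \<omega> \<omega>' \<longrightarrow> agree m (shiftZ i \<omega>) (shiftZ i \<omega>')" for m
    by (intro exI[of _ "m + nat \<bar>i\<bar>"]) (simp add: agree_def shiftZ_def)
qed

lemma ucont_glue: "ucont f \<Longrightarrow> ucont (\<lambda>\<omega>. f (glue \<Lambda> \<xi> \<omega>))"
proof (erule ucont_compose)
  show "\<exists>n. \<forall>\<omega> \<omega>'. agree n \<omega> \<omega>' \<longrightarrow> agree m (glue \<Lambda> \<xi> \<omega>) (glue \<Lambda> \<xi> \<omega>')" for m
    by (intro exI[of _ m]) (simp add: agree_def glue_def)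
qed

lemma ucont_diff: 
  fixes f :: "(int \<Rightarrow> 'e::finite) \<Rightarrow> real"
  shows "ucont f \<Longrightarrow> ucont g \<Longrightarrow> ucont (\<lambda>\<omega>. f \<omega> - g \<omega>)"
  unfolding continuous_iff_ucont[symmetric] by (rule continuous_map_diff)

lemma ucont_mult: 
  fixes f :: "(int \<Rightarrow> 'e::finite) \<Rightarrow> real"
  shows "ucont f \<Longrightarrow> ucont g \<Longrightarrow> ucont (\<lambda>\<omega>. f \<omega> * g \<omega>)"
  unfolding continuous_iff_ucont[symmetric] by (rule continuous_map_real_mult)

lemma ucont_ln:
  fixes f :: "(int \<Rightarrow> 'e::finite) \<Rightarrow> real"
  assumes "ucont f" "\<And>\<omega>. f \<omega> > 0" shows "ucont (\<lambda>\<omega>. ln (f \<omega>))"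
proof -
  have "continuous_map Omega_top (top_of_set {0<..}) f"
    using assms by (auto simp: continuous_map_in_subtopology continuous_iff_ucont)
  moreover have "continuous_map (top_of_set {0<..}) euclideanreal ln"
    unfolding continuous_map_iff_continuous by (intro continuous_on_ln continuous_on_id) auto
  ultimately have "continuous_map Omega_top euclideanreal (ln \<circ> f)"
    by (rule continuous_map_compose)
  then show ?thesis by (simp add: o_def continuous_iff_ucont)
qed

section \<open>Entropy of stationary processes\<close>

text \<open>Fekete's subadditive lemma; nonnegativity keeps the infimum of a(k)/k finite, and the
  limit is this infimum. Take m nearly optimal and divide k by m with remainder.\<close>

lemma fekete_nonneg:
  fixes a :: "nat \<Rightarrow> real"
  assumes sub: "\<And>m n. a (m + n) \<le> a m + a n" and nonneg: "\<And>n. a n \<ge> 0"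
  shows "convergent (\<lambda>n. a (Suc n) / real (Suc n))"
proof -
  define L where "L = (INF n. a (Suc n) / real (Suc n))"
  have bdd: "bdd_below (range (\<lambda>n. a (Suc n) / real (Suc n)))"
    by (rule bdd_belowI[of _ 0]) (auto simp: nonneg)
  have L_le: "L \<le> a (Suc n) / real (Suc n)" for n
    unfolding L_def by (rule cINF_lower[OF bdd]) simp
  have mult: "a (q * m + r) \<le> real q * a m + a r" for q m r
  proof (induction q)
    case (Suc q)
    then show ?case using sub[of m "q * m + r"] by (simp add: algebra_simps)
  qed simp
  have "(\<lambda>n. a (Suc n) / real (Suc n)) \<longlonglongrightarrow> L"
  proof (rule LIMSEQ_I)
    fix \<epsilon> :: real assume "\<epsilon> > 0"
    then obtain m0 where m0: "a (Suc m0) / real (Suc m0) < L + \<epsilon> / 2"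
      using cINF_less_iff[OF _ bdd, of "L + \<epsilon> / 2"] unfolding L_def by auto
    define m where "m = Suc m0"
    \<comment> \<open>One constant for all remainders modulo \<open>m\<close>; once k is large it
      costs less than half of \<epsilon> per unit of k.\<close>
    define C where "C = (\<Sum>r<m. a r)"
    have C: "a r \<le> C" if "r < m" for r
      unfolding C_def using that by (intro member_le_sum) (auto simp: nonneg)
    obtain N :: nat where N: "C / (\<epsilon> / 2) < real N" using reals_Archimedean2 by blast
    have "norm (a (Suc n) / real (Suc n) - L) < \<epsilon>" if "n \<ge> N" for n
    proof -
      define k where "k = Suc n"
      have "a k \<le> real (k div m) * a m + C"
        using mult[of "k div m" m "k mod m"] C[of "k mod m"]
        unfolding div_mult_mod_eq by (simp add: m_def)
      moreover have "real (k div m) * a m \<le> real k / real m * a m"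
        by (intro mult_right_mono nonneg) (rule of_nat_div_le_of_nat)
      moreover have "real k / real m * a m \<le> real k * (L + \<epsilon> / 2)"
        using mult_left_mono[OF less_imp_le[OF m0], of "real k"] by (simp add: m_def)
      moreover have "C < real k * (\<epsilon> / 2)"
      proof -
        have "C < real N * (\<epsilon> / 2)" using N \<open>\<epsilon> > 0\<close> by (simp add: field_simps)
        also have "\<dots> \<le> real k * (\<epsilon> / 2)"
          using that \<open>\<epsilon> > 0\<close> by (intro mult_right_mono) (auto simp: k_def)
        finally show ?thesis .
      qed
      ultimately have "a k < real k * (L + \<epsilon>)" by (simp add: algebra_simps)
      then have "a k / real k < L + \<epsilon>"
        by (simp add: k_def field_simps del: of_nat_Suc)
      then show ?thesis using L_le[of n] by (simp add: k_def abs_less_iff)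
    qed
    then show "\<exists>no. \<forall>n\<ge>no. norm (a (Suc n) / real (Suc n) - L) < \<epsilon>" by blast
  qed
  then show ?thesis by (rule convergentI)
qed

lemma shiftZ_0 [simp]: "shiftZ 0 = (\<lambda>\<omega>. \<omega>)"
  by (simp add: shiftZ_def fun_eq_iff)

lemma shiftZ_shiftZ [simp]: "shiftZ i (shiftZ j \<omega>) = shiftZ (i + j) \<omega>"
  by (simp add: shiftZ_def ac_simps)

lemma measurable_shiftZ: "shiftZ i \<in> Omega_M \<rightarrow>\<^sub>M (Omega_M :: (int \<Rightarrow> 'e) measure)"
  unfolding Omega_M_def shiftZ_def
  by (rule measurable_PiM_single') auto

lemma range_shiftZ: "range (\<lambda>\<omega>. X (shiftZ i \<omega>)) = range X"
proof -
  have "X \<omega> = X (shiftZ i (shiftZ (-i) \<omega>))" for \<omega> by simp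
  then show ?thesis by blast
qed

section \<open>Shift-invariant measures\<close>

locale stationary = prob_space M for M :: "(int \<Rightarrow> 'e::finite) measure" +
  assumes sets_M [measurable_cong]: "sets M = sets Omega_M"
    and shift_inv: "A \<in> sets M \<Longrightarrow> measure M (shift -` A \<inter> space M) = measure M A"

text \<open>With base \<open>exp 1\<close> the library's \<open>log\<close> becomes
  \<open>ln\<close>, the logarithm used in \<open>join_entropy\<close>.\<close>

sublocale stationary \<subseteq> information_space M "exp 1"
  by unfold_locales (simp add: one_less_exp_iff)

context stationary
begin

lemma space_M [simp]: "space M = UNIV"
  using sets_eq_imp_space_eq[OF sets_M] by simp

lemma prob_UNIV [simp]: "prob UNIV = 1"
  using prob_space by simp

lemma measurable_shiftZ_M [measurable]: "shiftZ i \<in> M \<rightarrow>\<^sub>M M"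
  using measurable_shiftZ by (simp cong: measurable_cong_sets add: measurable_cong_sets[OF sets_M sets_M])

text \<open>The shift is invertible: pushing \<open>distr M M (shiftZ 1)\<close>, which is
  \<open>M\<close>, forward by \<open>shiftZ (-1)\<close> undoes the shift, so the backward shift
  preserves \<open>M\<close> too. Integer induction does the rest.\<close>

lemma distr_shiftZ: "distr M M (shiftZ i) = M"
proof -
  have 1: "distr M M (shiftZ 1) = M"
  proof (rule measure_eqI)
    fix A assume "A \<in> sets (distr M M (shiftZ 1))"
    then have "A \<in> sets M" by simp
    then show "emeasure (distr M M (shiftZ 1)) A = emeasure M A"
      using shift_inv[of A] by (simp add: emeasure_distr emeasure_eq_measure shift_def)
  qed simp
  have add: "distr M M (shiftZ (i + j)) = M"
    if "distr M M (shiftZ i) = M" "distr M M (shiftZ j) = M" for i j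
  proof -
    have "distr M M (shiftZ (i + j)) = distr (distr M M (shiftZ j)) M (shiftZ i)"
      by (subst distr_distr) (auto simp: o_def)
    then show ?thesis using that by simp
  qed
  have "distr M M (shiftZ (-1)) = distr (distr M M (shiftZ 1)) M (shiftZ (-1))"
    by (simp add: 1)
  also have "\<dots> = M" by (subst distr_distr) (auto simp: o_def)
  finally have m1: "distr M M (shiftZ (-1)) = M" .
  show ?thesis
  proof (induction i rule: int_induct[of _ 0])
    case base then show ?case by simp
  next
    case (step1 i) then show ?case using add[OF _ 1] by simp
  next
    case (step2 i) then show ?case using add[OF _ m1] by simp
  qed
qed

lemma integral_shiftZ:
  fixes f :: "_ \<Rightarrow> real"
  assumes "f \<in> borel_measurable M" shows "(\<integral>\<omega>. f (shiftZ i \<omega>) \<partial>M) = (\<integral>\<omega>. f \<omega> \<partial>M)"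
  using integral_distr[OF measurable_shiftZ_M assms, of i] by (simp add: distr_shiftZ)

lemma prob_shiftZ:
  assumes "A \<in> sets M" shows "prob {\<omega>. shiftZ i \<omega> \<in> A} = prob A"
  using measure_distr[OF measurable_shiftZ_M assms, of i] by (simp add: distr_shiftZ vimage_def)

lemma simple_set: "simple_function M X \<Longrightarrow> {\<omega>. X \<omega> \<in> A} \<in> sets M"
  using simple_functionD(2)[of M X A] by (simp add: vimage_def)

lemma simple_shiftZ:
  assumes "simple_function M X" shows "simple_function M (\<lambda>\<omega>. X (shiftZ i \<omega>))"
  unfolding simple_function_def
proof safe
  show "finite ((\<lambda>\<omega>. X (shiftZ i \<omega>)) ` space M)"
    using simple_functionD(1)[OF assms] by (simp add: range_shiftZ)
  show "(\<lambda>\<omega>. X (shiftZ i \<omega>)) -` {x} \<inter> space M \<in> sets M" for x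
    using measurable_sets[OF measurable_shiftZ_M simple_set[OF assms, of "{x}"], of i]
    by (simp add: vimage_def)
qed

section \<open>Shannon entropy of finite-valued variables\<close>

definition ent :: "((int \<Rightarrow> 'e) \<Rightarrow> 'b) \<Rightarrow> real" where
  "ent X = entropy (exp 1) (count_space (X ` space M)) X"

text \<open>Values that are never attained contribute 0, so the sum may run over any finite superset
  of the range. This allows sums over all words, as in \<open>join_entropy\<close>.\<close>

lemma entropy_eq_sum:
  assumes X: "simple_function M X" and S: "finite S" "range X \<subseteq> S"
  shows "ent X = - (\<Sum>x\<in>S. prob {\<omega>. X \<omega> = x} * ln (prob {\<omega>. X \<omega> = x}))"
proof -
  have "simple_distributed M X (\<lambda>x. prob {\<omega>. X \<omega> = x})"
    by (rule simple_distributedI[OF X]) (auto simp: vimage_def)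
  then have "ent X = - (\<Sum>x\<in>range X. prob {\<omega>. X \<omega> = x} * ln (prob {\<omega>. X \<omega> = x}))"
    using entropy_simple_distributed by (simp add: log_def ent_def)
  also have "(\<Sum>x\<in>range X. prob {\<omega>. X \<omega> = x} * ln (prob {\<omega>. X \<omega> = x}))
      = (\<Sum>x\<in>S. prob {\<omega>. X \<omega> = x} * ln (prob {\<omega>. X \<omega> = x}))"
  proof (rule sum.mono_neutral_left[OF S], intro ballI)
    fix x assume "x \<in> S - range X"
    then have "{\<omega>. X \<omega> = x} = {}" by auto
    then show "prob {\<omega>. X \<omega> = x} * ln (prob {\<omega>. X \<omega> = x}) = 0" by simp
  qed
  finally show ?thesis .
qed

lemma entropy_shiftZ:
  assumes "simple_function M X" shows "ent (\<lambda>\<omega>. X (shiftZ i \<omega>)) = ent X"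
proof -
  have "prob {\<omega>. X (shiftZ i \<omega>) = x} = prob {\<omega>. X \<omega> = x}" for x
    using prob_shiftZ[OF simple_set[OF assms, of "{x}"], of i] by simp
  then show ?thesis
    using entropy_eq_sum[OF simple_shiftZ[OF assms], of "range X" i]
      entropy_eq_sum[OF assms, of "range X"] simple_functionD(1)[OF assms]
    by (simp add: range_shiftZ)
qed

lemma entropy_pair_le:
  "simple_function M X \<Longrightarrow> simple_function M Y \<Longrightarrow> ent (\<lambda>\<omega>. (X \<omega>, Y \<omega>)) \<le> ent X + ent Y"
  using entropy_chain_rule[of X Y] conditional_entropy_less_eq_entropy[of Y X] by (simp add: ent_def)

lemma entropy_function_le:
  assumes "simple_function M X" "\<And>\<omega>. Y \<omega> = f (X \<omega>)" shows "ent Y \<le> ent X"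
proof -
  have "Y = f \<circ> X" using assms(2) by auto
  then show ?thesis using entropy_data_processing[OF assms(1), of f] by (simp add: ent_def)
qed

lemma entropy_nonneg:
  assumes "simple_function M X" shows "ent X \<ge> 0"
proof -
  have "prob A * ln (prob A) \<le> 0" for A
    using prob_le_1[of A] measure_nonneg[of M A]
    by (cases "prob A = 0") (auto intro!: mult_nonneg_nonpos simp: less_le)
  then show ?thesis
    using entropy_eq_sum[OF assms, of "range X"] simple_functionD(1)[OF assms]
    by (simp add: sum_nonpos)
qed

lemma integral_simple:
  fixes g :: "_ \<Rightarrow> real"
  assumes X: "simple_function M X" and S: "finite S" "range X \<subseteq> S"
  shows "integrable M (\<lambda>\<omega>. g (X \<omega>))"
    and "(\<integral>\<omega>. g (X \<omega>) \<partial>M) = (\<Sum>x\<in>S. prob {\<omega>. X \<omega> = x} * g x)"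
proof -
  have eq: "g (X \<omega>) = (\<Sum>x\<in>S. indicator {\<omega>. X \<omega> = x} \<omega> * g x)" for \<omega>
  proof -
    have "(\<Sum>x\<in>S. indicator {\<omega>. X \<omega> = x} \<omega> * g x) = (\<Sum>x\<in>S. if x = X \<omega> then g x else 0)"
      by (rule sum.cong) (auto simp: indicator_def)
    also have "\<dots> = g (X \<omega>)" using S by (simp add: image_subset_iff)
    finally show ?thesis by simp
  qed
  have meas: "{\<omega>. X \<omega> = x} \<in> sets M" for x
    using simple_set[OF X, of "{x}"] by simp
  have int: "integrable M (\<lambda>\<omega>. indicator {\<omega>. X \<omega> = x} \<omega> * g x)" for x
    using meas by (intro integrable_mult_left integrable_real_indicator) (auto simp: emeasure_eq_measure)
  show "integrable M (\<lambda>\<omega>. g (X \<omega>))"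
    unfolding eq using int by simp
  show "(\<integral>\<omega>. g (X \<omega>) \<partial>M) = (\<Sum>x\<in>S. prob {\<omega>. X \<omega> = x} * g x)"
    unfolding eq using int meas by (subst Bochner_Integration.integral_sum) auto
qed

text \<open>Gibbs' inequality for a subprobability \<open>q\<close>, from 1 + y \<le> exp y. The
  separate \<open>u\<close> stands for ln q and is constrained only at values of positive
  probability, so the convention for the logarithm of 0 never enters.\<close>

lemma entropy_le_cross_entropy:
  assumes X: "simple_function M X" and S: "finite S" "range X \<subseteq> S"
    and q: "\<And>x. x \<in> S \<Longrightarrow> q x \<ge> 0" "(\<Sum>x\<in>S. q x) \<le> 1"
    and u: "\<And>x. x \<in> S \<Longrightarrow> prob {\<omega>. X \<omega> = x} > 0 \<Longrightarrow> exp (u x) \<le> q x"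
  shows "ent X \<le> - (\<integral>\<omega>. u (X \<omega>) \<partial>M)"
proof -
  let ?p = "\<lambda>x. prob {\<omega>. X \<omega> = x}"
  have "?p x * u x - ?p x * ln (?p x) \<le> q x - ?p x" if "x \<in> S" for x
  proof (cases "?p x = 0")
    case True then show ?thesis using q(1)[OF that] by simp
  next
    case False
    then have pos: "?p x > 0" using measure_nonneg[of M] by (simp add: less_le)
    have "u x - ln (?p x) \<le> exp (u x - ln (?p x)) - 1"
      using exp_ge_add_one_self[of "u x - ln (?p x)"] by linarith
    also have "\<dots> = exp (u x) / ?p x - 1" using pos by (simp add: exp_diff)
    also have "\<dots> \<le> q x / ?p x - 1" using u[OF that pos] pos by (simp add: divide_right_mono)
    finally have "?p x * (u x - ln (?p x)) \<le> ?p x * (q x / ?p x - 1)"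
      using pos by (intro mult_left_mono) auto
    then show ?thesis using pos by (simp add: algebra_simps)
  qed
  then have "(\<Sum>x\<in>S. ?p x * u x - ?p x * ln (?p x)) \<le> (\<Sum>x\<in>S. q x - ?p x)"
    by (rule sum_mono)
  moreover have "(\<Sum>x\<in>S. ?p x) = 1"
    using integral_simple(2)[OF X S, of "\<lambda>_. 1"] by simp
  ultimately show ?thesis
    using q(2) unfolding entropy_eq_sum[OF X S] integral_simple(2)[OF X S]
    by (simp add: sum_subtractf)
qed

section \<open>Itineraries and their entropy\<close>

definition path :: "(_ \<Rightarrow> 'b) \<Rightarrow> nat \<Rightarrow> _ \<Rightarrow> nat \<Rightarrow> 'b" where
  "path X n \<omega> = (\<lambda>j\<in>{..<n}. X (shiftZ (int j) \<omega>))"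

lemma simple_path:
  assumes "simple_function M X" shows "simple_function M (path X n)"
  unfolding simple_function_def
proof safe
  have "range (path X n) \<subseteq> PiE {..<n} (\<lambda>_. range X)"
    unfolding path_def by (intro image_subsetI restrict_PiE_iff[THEN iffD2]) simp
  then show "finite (path X n ` space M)"
    using simple_functionD(1)[OF assms] by (auto intro!: finite_PiE elim!: finite_subset)
  fix \<omega>
  have 1: "{\<omega>'. X (shiftZ j \<omega>') = x} \<in> sets M" for j x
    using simple_set[OF simple_shiftZ[OF assms, of j], of "{x}"] by simp
  have "path X n -` {path X n \<omega>} \<inter> space M
      = {\<omega>' \<in> space M. \<forall>j\<in>{..<n}. X (shiftZ (int j) \<omega>') = X (shiftZ (int j) \<omega>)}"
    by (auto simp: path_def fun_eq_iff restrict_def split: if_splits)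
  also have "\<dots> \<in> sets M"
    by (rule sets.sets_Collect_finite_All) (simp_all add: 1)
  finally show "path X n -` {path X n \<omega>} \<inter> space M \<in> sets M" .
qed

text \<open>A path of length m + n is a function of its first m entries and of the path of length n
  started at time m; by stationarity the latter has the entropy of \<open>path X n\<close>.\<close>

lemma entropy_path_subadd:
  assumes X: "simple_function M X"
  shows "ent (path X (m + n)) \<le> ent (path X m) + ent (path X n)"
proof -
  let ?Y = "\<lambda>\<omega>. path X n (shiftZ (int m) \<omega>)"
  have Y: "simple_function M ?Y" by (intro simple_shiftZ simple_path X)
  have "path X (m + n) \<omega> = (\<lambda>(u, v). \<lambda>j\<in>{..<m + n}. if j < m then u j else v (j - m)) (path X m \<omega>, ?Y \<omega>)" for \<omega>
    by (auto simp: path_def fun_eq_iff of_nat_diff)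
  then have "ent (path X (m + n)) \<le> ent (\<lambda>\<omega>. (path X m \<omega>, ?Y \<omega>))"
    by (rule entropy_function_le[OF simple_function_Pair[OF simple_path[OF X] Y]])
  also have "\<dots> \<le> ent (path X m) + ent ?Y" by (intro entropy_pair_le simple_path X Y)
  also have "ent ?Y = ent (path X n)" by (intro entropy_shiftZ simple_path X)
  finally show ?thesis .
qed

lemma entropy_path_convergent:
  "simple_function M X \<Longrightarrow> convergent (\<lambda>n. ent (path X (Suc n)) / real (Suc n))"
  by (intro fekete_nonneg[of "\<lambda>n. ent (path X n)"] entropy_path_subadd entropy_nonneg simple_path)

section \<open>Approximation in measure by local sets and functions\<close>

lemma local_set_measurable_M: "local_fun m (\<lambda>\<omega>. \<omega> \<in> B) \<Longrightarrow> B \<in> sets M"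
  unfolding sets_M by (rule local_set_measurable)

lemma local_fun_simple:
  assumes "local_fun m f" shows "simple_function M f"
  unfolding simple_function_def
proof safe
  show "finite (f ` space M)" using local_fun_finite_range[OF assms] by simp
  show "f -` {f x} \<inter> space M \<in> sets M" for x
    using assms by (intro local_set_measurable_M[of m]) (auto simp: local_fun_def)
qed

text \<open>The sets that local sets approximate in measure contain the one-coordinate generators
  and are closed under complement and countable union; induction over the generated
  sigma-algebra.\<close>

lemma approx_by_local_set:
  assumes "A \<in> sets M" "\<epsilon> > 0"
  shows "\<exists>m B. local_fun m (\<lambda>\<omega>. \<omega> \<in> B) \<and> prob ((A - B) \<union> (B - A)) < \<epsilon>"
proof -
  have "A \<in> sigma_sets UNIV {{f :: int \<Rightarrow> 'e. f i \<in> A} | i A. True}"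
    using assms(1) unfolding sets_M Omega_M_def sets_PiM_single by simp
  then show ?thesis using assms(2)
  proof (induction arbitrary: \<epsilon>)
    case (Basic A)
    then obtain i E where A: "A = {f. f i \<in> E}" by blast
    then have "local_fun (nat \<bar>i\<bar>) (\<lambda>\<omega>. \<omega> \<in> A)"
      by (auto simp: local_fun_def agree_def)
    then show ?case using Basic.prems by (intro exI[of _ "nat \<bar>i\<bar>"] exI[of _ A]) simp
  next
    case Empty
    then show ?case by (intro exI[of _ 0] exI[of _ "{}"]) (simp add: local_fun_def)
  next
    case (Compl A)
    then obtain m B where B: "local_fun m (\<lambda>\<omega>. \<omega> \<in> B)" "prob ((A - B) \<union> (B - A)) < \<epsilon>" by blast
    have "(UNIV - A - - B) \<union> (- B - (UNIV - A)) = (A - B) \<union> (B - A)" by blast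
    then show ?case using B by (intro exI[of _ m] exI[of _ "- B"]) (simp add: local_fun_def)
  next
    case (Union A)
    have sets: "A i \<in> sets M" for i
      using Union.hyps[of i] unfolding sets_M Omega_M_def sets_PiM_single by simp
    let ?U = "\<lambda>n. \<Union>i\<le>n. A i"
    have "(\<lambda>n. prob (?U n)) \<longlonglongrightarrow> prob (\<Union>n. ?U n)"
    proof (rule finite_Lim_measure_incseq)
      show "range ?U \<subseteq> sets M" using sets by auto
      show "incseq ?U" unfolding incseq_def by (intro allI impI UN_mono) auto
    qed
    moreover have "(\<Union>n. ?U n) = (\<Union>i. A i)" by auto
    ultimately obtain n where n: "\<bar>prob (?U n) - prob (\<Union>i. A i)\<bar> < \<epsilon> / 2"
      using LIMSEQ_D[of _ _ "\<epsilon> / 2"] \<open>\<epsilon> > 0\<close> by (metis half_gt_zero order_refl real_norm_def)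
    \<comment> \<open>Cutting the union after index n costs less than \<epsilon>/2; the n + 1
      remaining sets share the other \<epsilon>/2 equally.\<close>
    have "\<forall>i. \<exists>m B. local_fun m (\<lambda>\<omega>. \<omega> \<in> B) \<and> prob ((A i - B) \<union> (B - A i)) < \<epsilon> / (2 * real (Suc n))"
      using Union.IH \<open>\<epsilon> > 0\<close> by simp
    then obtain m B where B: "\<And>i. local_fun (m i) (\<lambda>\<omega>. \<omega> \<in> B i)"
        "\<And>i. prob ((A i - B i) \<union> (B i - A i)) < \<epsilon> / (2 * real (Suc n))"
      by metis
    let ?N = "\<Sum>i\<le>n. m i" and ?B = "\<Union>i\<le>n. B i"
    have Bs: "B i \<in> sets M" for i using B(1) by (rule local_set_measurable_M)
    have "local_fun ?N (\<lambda>\<omega>. \<omega> \<in> B i)" if "i \<le> n" for i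
      using that by (intro local_fun_mono[OF B(1)] member_le_sum) auto
    then have loc: "local_fun ?N (\<lambda>\<omega>. \<omega> \<in> ?B)"
      by (auto simp: local_fun_def)
    let ?D = "\<lambda>i. (A i - B i) \<union> (B i - A i)"
    have "prob (((\<Union>i. A i) - ?B) \<union> (?B - (\<Union>i. A i))) \<le> prob (((\<Union>i. A i) - ?U n) \<union> (\<Union>i\<le>n. ?D i))"
      using sets Bs by (intro finite_measure_mono) auto
    also have "\<dots> \<le> prob ((\<Union>i. A i) - ?U n) + prob (\<Union>i\<le>n. ?D i)"
      using sets Bs by (intro measure_Un_le) auto
    also have "prob ((\<Union>i. A i) - ?U n) = prob (\<Union>i. A i) - prob (?U n)"
      using sets by (intro finite_measure_Diff) auto
    also have "\<dots> < \<epsilon> / 2" using n by linarith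
    also have "prob (\<Union>i\<le>n. ?D i) \<le> (\<Sum>i\<le>n. prob (?D i))"
      using sets Bs by (intro finite_measure_subadditive_finite) auto
    also have "\<dots> \<le> (\<Sum>i\<le>n. \<epsilon> / (2 * real (Suc n)))"
      using B(2) by (intro sum_mono) (simp add: less_imp_le)
    also have "\<dots> = \<epsilon> / 2" by (simp add: field_simps)
    finally have "prob (((\<Union>i. A i) - ?B) \<union> (?B - (\<Union>i. A i))) < \<epsilon>" by simp
    with loc show ?case by blast
  qed
qed

text \<open>Approximate the level sets of \<open>X\<close> separately. Outside the union of the
  errors, exactly one approximating set contains the point, and its index is the value of
  \<open>X\<close>.\<close>

lemma approx_by_local_fun:
  fixes X :: "(int \<Rightarrow> 'e) \<Rightarrow> nat"
  assumes X: "simple_function M X" and "\<epsilon> > 0"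
  shows "\<exists>m f. local_fun m f \<and> prob {\<omega>. X \<omega> \<noteq> f \<omega>} < \<epsilon>"
proof -
  obtain k where k: "\<And>\<omega>. X \<omega> < k"
    using simple_functionD(1)[OF X] finite_nat_set_iff_bounded[of "range X"] by auto
  then have "k > 0" using gr0I not_less0 by metis
  let ?A = "\<lambda>i. {\<omega>. X \<omega> = i}"
  have A: "?A i \<in> sets M" for i using simple_set[OF X, of "{i}"] by simp
  have "\<forall>i. \<exists>m B. local_fun m (\<lambda>\<omega>. \<omega> \<in> B) \<and> prob ((?A i - B) \<union> (B - ?A i)) < \<epsilon> / real k"
    using approx_by_local_set[OF A] \<open>\<epsilon> > 0\<close> \<open>k > 0\<close> by simp
  then obtain m B where B: "\<And>i. local_fun (m i) (\<lambda>\<omega>. \<omega> \<in> B i)"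
      "\<And>i. prob ((?A i - B i) \<union> (B i - ?A i)) < \<epsilon> / real k"
    by metis
  define N where "N = (\<Sum>i<k. m i)"
  have Bs: "B i \<in> sets M" for i using B(1) by (rule local_set_measurable_M)
  \<comment> \<open>Where no \<open>B i\<close> contains the point, \<open>LEAST\<close> returns an
    unspecified value, possibly not below \<open>k\<close>. It is the same for all such points, so
    \<open>f\<close> stays local, and they all lie in the error set.\<close>
  define f :: "(int \<Rightarrow> 'e) \<Rightarrow> nat" where "f \<omega> = (LEAST i. i < k \<and> \<omega> \<in> B i)" for \<omega>
  have loc: "local_fun N f"
    unfolding local_fun_def
  proof (intro allI impI)
    fix \<omega> \<omega>' :: "int \<Rightarrow> 'e" assume ag: "agree N \<omega> \<omega>'"
    have "local_fun N (\<lambda>\<omega>. \<omega> \<in> B i)" if "i < k" for i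
      unfolding N_def using that by (intro local_fun_mono[OF B(1)] member_le_sum) auto
    then have "i < k \<and> \<omega> \<in> B i \<longleftrightarrow> i < k \<and> \<omega>' \<in> B i" for i
      using ag unfolding local_fun_def by blast
    then show "f \<omega> = f \<omega>'" unfolding f_def by simp
  qed
  let ?D = "\<lambda>i. (?A i - B i) \<union> (B i - ?A i)"
  have sub: "{\<omega>. X \<omega> \<noteq> f \<omega>} \<subseteq> (\<Union>i<k. ?D i)"
  proof (rule subsetI, rule ccontr)
    fix \<omega> assume \<omega>: "\<omega> \<in> {\<omega>. X \<omega> \<noteq> f \<omega>}" "\<omega> \<notin> (\<Union>i<k. ?D i)"
    have "\<omega> \<notin> ?D i" if "i < k" for i using \<omega>(2) that by blast
    then have "\<omega> \<in> B i \<longleftrightarrow> i = X \<omega>" if "i < k" for i using that by blast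
    then have "i < k \<and> \<omega> \<in> B i \<longleftrightarrow> i = X \<omega>" for i using k[of \<omega>] by blast
    then have "f \<omega> = X \<omega>" unfolding f_def by (intro Least_equality) simp_all
    with \<omega>(1) show False by simp
  qed
  have "prob {\<omega>. X \<omega> \<noteq> f \<omega>} \<le> prob (\<Union>i<k. ?D i)"
    using A Bs by (intro finite_measure_mono[OF sub]) auto
  also have "\<dots> \<le> (\<Sum>i<k. prob (?D i))"
    using A Bs by (intro finite_measure_subadditive_finite) auto
  also have "\<dots> < (\<Sum>i<k. \<epsilon> / real k)"
    using B(2) \<open>k > 0\<close> by (intro sum_strict_mono) auto
  also have "\<dots> = \<epsilon>" using \<open>k > 0\<close> by simp
  finally show ?thesis using loc by blast
qed

section \<open>Entropy of a process against entropy of words\<close>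

definition word :: "nat \<Rightarrow> (int \<Rightarrow> 'e) \<Rightarrow> int \<Rightarrow> 'e" where
  "word n \<omega> = restrict \<omega> {0..<int n}"

lemma range_word: "range (word n) \<subseteq> local_configs {0..<int n}"
  by (auto simp: word_def)

lemma simple_word: "simple_function M (word n)"
  by (rule local_fun_simple[of n]) (auto simp: local_fun_def agree_def word_def intro!: restrict_ext)

text \<open>
  Gibbs' inequality against the law that draws the word of the process first and then every letter of the
  path independently, equal to its local prediction \<open>f\<close> with weight \<open>1 - d\<close>.
\<close>

lemma entropy_path_le:
  fixes X :: "(int \<Rightarrow> 'e) \<Rightarrow> nat"
  assumes X: "simple_function M X" and k: "\<And>\<omega>. X \<omega> < k"
    and f: "local_fun m f" and d: "0 < d" "d < 1" and err: "prob {\<omega>. X \<omega> \<noteq> f \<omega>} \<le> d"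
  shows "ent (path X n) \<le> ent (word (n + 2 * m)) + real n * (- ln (1 - d) - d * ln (d / real k))"
proof -
  have "k > 0" using k gr0I not_less0 by metis
  \<comment> \<open>The word is started at time -m and prolonged by m on the right, so that it
    determines the predictions \<open>f\<close> at all times 0, ..., n - 1. Shifting by j + m
    recentres it at time j.\<close>
  define Y where "Y \<omega> = word (n + 2 * m) (shiftZ (- int m) \<omega>)" for \<omega>
  have Y: "simple_function M Y" unfolding Y_def by (intro simple_shiftZ simple_word)
  \<comment> \<open>Weight of letter \<open>i\<close> when \<open>j\<close> is predicted. As
    \<open>f\<close> may predict values not below \<open>k\<close>, and the d/k at a correct
    prediction is dropped, the weights sum to at most 1 rather than exactly 1.\<close>
  define r :: "nat \<Rightarrow> nat \<Rightarrow> real" where "r i j = (if i = j then 1 - d else d / real k)" for i j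
  have r_pos: "r i j > 0" for i j using d \<open>k > 0\<close> by (simp add: r_def)
  have r_sum: "(\<Sum>i<k. r i j) \<le> 1" for j
  proof -
    have "(\<Sum>i<k. r i j) \<le> (\<Sum>i<k. (if i = j then 1 - d else 0) + d / real k)"
      using d \<open>k > 0\<close> by (intro sum_mono) (simp add: r_def)
    also have "\<dots> \<le> 1" using d \<open>k > 0\<close> by (simp add: sum.distrib)
    finally show ?thesis .
  qed
  have fY: "f (shiftZ (int j) \<omega>) = f (shiftZ (int j + int m) (Y \<omega>))" if "j < n" for j \<omega>
  proof -
    have "agree m (shiftZ (int j) \<omega>) (shiftZ (int j + int m) (Y \<omega>))"
      using that by (auto simp: agree_def shiftZ_def Y_def word_def)
    with f show ?thesis by (simp add: local_fun_def)
  qed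
  let ?SX = "PiE {..<n} (\<lambda>_. {..<k})" and ?SY = "local_configs {0..<int (n + 2 * m)} :: (int \<Rightarrow> 'e) set"
  let ?Z = "\<lambda>\<omega>. (path X n \<omega>, Y \<omega>)"
  let ?p = "\<lambda>y. prob {\<omega>. Y \<omega> = y}"
  have Z: "simple_function M ?Z" by (intro simple_function_Pair simple_path X Y)
  have rX: "range (path X n) \<subseteq> ?SX"
    using k unfolding path_def by (intro image_subsetI restrict_PiE_iff[THEN iffD2]) simp
  have rY: "range Y \<subseteq> ?SY" using range_word unfolding Y_def by blast
  have fin: "finite ?SX" "finite ?SY" by (auto intro!: finite_PiE)
  define R where "R x y = (\<Prod>j<n. r (x j) (f (shiftZ (int j + int m) y)))" for x y
  \<comment> \<open>The logarithm of the comparison law \<open>?p y * R x y\<close> at words of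
    positive probability; elsewhere the law vanishes and the value of \<open>u\<close> is
    irrelevant.\<close>
  define u where "u = (\<lambda>(x, y). ln (?p y) + (\<Sum>j<n. ln (r (x j) (f (shiftZ (int j + int m) y)))))"
  have R_nonneg: "R x y \<ge> 0" for x y
    unfolding R_def using r_pos by (intro prod_nonneg) (simp add: less_imp_le)
  have R_sum: "(\<Sum>x\<in>?SX. R x y) \<le> 1" for y
  proof -
    have "(\<Sum>x\<in>?SX. R x y) = (\<Prod>j<n. \<Sum>i<k. r i (f (shiftZ (int j + int m) y)))"
      unfolding R_def by (subst prod_sum_PiE) auto
    also have "\<dots> \<le> 1"
      using r_sum r_pos by (intro prod_le_1) (auto intro!: sum_nonneg simp: less_imp_le)
    finally show ?thesis .
  qed
  have Y_sum: "(\<Sum>y\<in>?SY. ?p y) = 1"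
    using integral_simple(2)[OF Y fin(2) rY, of "\<lambda>_. 1"] by simp
  have "ent (path X n) \<le> ent ?Z" by (rule entropy_function_le[OF Z, of _ fst]) simp
  also have "ent ?Z \<le> - (\<integral>\<omega>. u (?Z \<omega>) \<partial>M)"
  proof (rule entropy_le_cross_entropy[OF Z, of "?SX \<times> ?SY" "\<lambda>(x, y). ?p y * R x y"])
    show "finite (?SX \<times> ?SY)" using fin by blast
    show "range ?Z \<subseteq> ?SX \<times> ?SY" using rX rY by blast
    show "(case z of (x, y) \<Rightarrow> ?p y * R x y) \<ge> 0" for z
      using R_nonneg by (auto split: prod.split)
    have "(\<Sum>(x, y)\<in>?SX \<times> ?SY. ?p y * R x y) = (\<Sum>x\<in>?SX. \<Sum>y\<in>?SY. ?p y * R x y)"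
      by (rule sum.cartesian_product[symmetric])
    also have "\<dots> = (\<Sum>y\<in>?SY. \<Sum>x\<in>?SX. ?p y * R x y)"
      by (rule sum.swap)
    also have "\<dots> = (\<Sum>y\<in>?SY. ?p y * (\<Sum>x\<in>?SX. R x y))"
      by (simp add: sum_distrib_left)
    also have "\<dots> \<le> (\<Sum>y\<in>?SY. ?p y)"
      using R_sum by (intro sum_mono) (simp add: mult_left_le)
    finally show "(\<Sum>(x, y)\<in>?SX \<times> ?SY. ?p y * R x y) \<le> 1" using Y_sum by simp
    fix z assume z: "prob {\<omega>. ?Z \<omega> = z} > 0"
    obtain x y where xy: "z = (x, y)" by (cases z)
    have "{\<omega>. Y \<omega> = y} \<in> sets M" using simple_set[OF Y, of "{y}"] by simp
    then have "prob {\<omega>. ?Z \<omega> = z} \<le> ?p y"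
      by (intro finite_measure_mono) (auto simp: xy)
    with z have "?p y > 0" by linarith
    then show "exp (u z) \<le> (case z of (x, y) \<Rightarrow> ?p y * R x y)"
      using r_pos by (simp add: xy u_def R_def exp_add exp_sum)
  qed
  also have "(\<integral>\<omega>. u (?Z \<omega>) \<partial>M) = (\<integral>\<omega>. ln (?p (Y \<omega>)) + (\<Sum>j<n. ln (r (X (shiftZ (int j) \<omega>)) (f (shiftZ (int j) \<omega>)))) \<partial>M)"
    by (intro Bochner_Integration.integral_cong refl) (simp add: u_def path_def fY)
  \<comment> \<open>Averaging the first term gives minus the entropy of the word, and stationarity
    makes the n prediction terms equal in mean.\<close>
  also have "\<dots> = - ent Y + real n * (\<integral>\<omega>. ln (r (X \<omega>) (f \<omega>)) \<partial>M)"
  proof -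
    let ?W = "\<lambda>\<omega>. (X \<omega>, f \<omega>)"
    have W: "simple_function M ?W" by (intro simple_function_Pair X local_fun_simple[OF f])
    let ?g = "\<lambda>\<omega>. ln (r (X \<omega>) (f \<omega>))"
    have int: "integrable M (\<lambda>\<omega>. ?g (shiftZ j \<omega>))" for j
      using integral_simple(1)[OF simple_shiftZ[OF W, of j], of _ "\<lambda>(a, b). ln (r a b)"]
        simple_functionD(1)[OF simple_shiftZ[OF W, of j]] by simp
    have "(\<integral>\<omega>. ?g (shiftZ j \<omega>) \<partial>M) = (\<integral>\<omega>. ?g \<omega> \<partial>M)" for j
      using int[of 0] by (intro integral_shiftZ) auto
    then have "(\<integral>\<omega>. (\<Sum>j<n. ?g (shiftZ (int j) \<omega>)) \<partial>M) = real n * (\<integral>\<omega>. ?g \<omega> \<partial>M)"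
      using int by (subst Bochner_Integration.integral_sum) auto
    moreover have "(\<integral>\<omega>. ln (?p (Y \<omega>)) \<partial>M) = - ent Y"
      using integral_simple(2)[OF Y fin(2) rY, of "\<lambda>y. ln (?p y)"] entropy_eq_sum[OF Y fin(2) rY] by simp
    ultimately show ?thesis
      using int integral_simple(1)[OF Y fin(2) rY, of "\<lambda>y. ln (?p y)"]
      by (subst Bochner_Integration.integral_add) auto
  qed
  also have "ent Y = ent (word (n + 2 * m))"
    unfolding Y_def by (intro entropy_shiftZ simple_word)
  finally have main: "ent (path X n) \<le> ent (word (n + 2 * m)) - real n * (\<integral>\<omega>. ln (r (X \<omega>) (f \<omega>)) \<partial>M)"
    by simp
  let ?E = "{\<omega>. X \<omega> \<noteq> f \<omega>}"
  have W: "simple_function M (\<lambda>\<omega>. (X \<omega>, f \<omega>))" by (intro simple_function_Pair X local_fun_simple[OF f])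
  have E: "?E \<in> sets M"
    using simple_set[OF W, of "{(a, b). a \<noteq> b}"] by simp
  have intE: "integrable M (indicat_real ?E)"
    using E by (intro integrable_real_indicator) (auto simp: emeasure_eq_measure)
  have "ln (1 - d) \<le> 0" "ln (d / real k) \<le> 0" using d \<open>k > 0\<close> by auto
  \<comment> \<open>Both logarithms are at most 0: the error probability may be raised to
    \<open>d\<close>, and ln(1 - d) may be charged even at wrong predictions.\<close>
  have "ln (1 - d) + d * ln (d / real k) \<le> ln (1 - d) + prob ?E * ln (d / real k)"
    using err \<open>ln (d / real k) \<le> 0\<close> by (simp add: mult_right_mono_neg)
  also have "\<dots> = (\<integral>\<omega>. ln (1 - d) + indicator ?E \<omega> * ln (d / real k) \<partial>M)"
    using E intE by (subst Bochner_Integration.integral_add) auto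
  also have "\<dots> \<le> (\<integral>\<omega>. ln (r (X \<omega>) (f \<omega>)) \<partial>M)"
  proof (rule integral_mono)
    show "integrable M (\<lambda>\<omega>. ln (1 - d) + indicator ?E \<omega> * ln (d / real k))" using intE by auto
    show "integrable M (\<lambda>\<omega>. ln (r (X \<omega>) (f \<omega>)))"
      using integral_simple(1)[OF W, of _ "\<lambda>(a, b). ln (r a b)"] simple_functionD(1)[OF W] by simp
    show "ln (1 - d) + indicator ?E \<omega> * ln (d / real k) \<le> ln (r (X \<omega>) (f \<omega>))" for \<omega>
      using \<open>ln (1 - d) \<le> 0\<close> by (simp add: r_def indicator_def)
  qed
  finally have "real n * (ln (1 - d) + d * ln (d / real k)) \<le> real n * (\<integral>\<omega>. ln (r (X \<omega>) (f \<omega>)) \<partial>M)"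
    by (intro mult_left_mono) auto
  with main show ?thesis by (simp add: algebra_simps)
qed

end

section \<open>The Kolmogorov--Sinai theorem\<close>

context stationary
begin

text \<open>Recodes a partition as the variable \<open>X\<close> naming the cell of a point. The
  cells of the n-fold join then become the level sets of \<open>path X n\<close>, so everything
  proved about paths applies.\<close>

lemma partition_path:
  assumes "is_fin_partition M \<alpha> k"
  obtains X where "simple_function M X" "\<And>\<omega>. X \<omega> < k" "\<And>\<omega>. \<omega> \<in> \<alpha> (X \<omega>)"
    "\<And>n. join_entropy M \<alpha> k n = ent (path X n)"
proof -
  have \<alpha>: "\<And>i. i < k \<Longrightarrow> \<alpha> i \<in> sets M" "\<And>i j. i < k \<Longrightarrow> j < k \<Longrightarrow> i \<noteq> j \<Longrightarrow> \<alpha> i \<inter> \<alpha> j = {}"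
    and cover: "(\<Union>i<k. \<alpha> i) = UNIV"
    using assms by (auto simp: is_fin_partition_def)
  have "\<forall>\<omega>. \<exists>i. i < k \<and> \<omega> \<in> \<alpha> i" using cover by blast
  then obtain X where X: "\<And>\<omega>. X \<omega> < k" "\<And>\<omega>. \<omega> \<in> \<alpha> (X \<omega>)" by metis
  have iff: "\<omega> \<in> \<alpha> i \<longleftrightarrow> X \<omega> = i" if "i < k" for i \<omega>
    using \<alpha>(2)[OF that X(1)[of \<omega>]] X(2)[of \<omega>] by auto
  have simple: "simple_function M X"
    unfolding simple_function_def
  proof safe
    have "range X \<subseteq> {..<k}" using X(1) by auto
    then show "finite (X ` space M)" using finite_subset by auto
    fix \<omega>
    have "X -` {X \<omega>} \<inter> space M = \<alpha> (X \<omega>)" using iff[OF X(1)[of \<omega>]] by auto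
    then show "X -` {X \<omega>} \<inter> space M \<in> sets M" using \<alpha>(1)[OF X(1)] by simp
  qed
  have "join_entropy M \<alpha> k n = ent (path X n)" for n
  proof -
    let ?S = "PiE {..<n} (\<lambda>_. {..<k})"
    have rX: "range (path X n) \<subseteq> ?S"
      using X(1) unfolding path_def by (intro image_subsetI restrict_PiE_iff[THEN iffD2]) simp
    have "space M \<inter> (\<Inter>j<n. shiftZ (int j) -` \<alpha> (w j)) = {\<omega>. path X n \<omega> = w}" if w: "w \<in> ?S" for w
    proof (rule set_eqI)
      fix \<omega>
      have "path X n \<omega> = w \<longleftrightarrow> (\<forall>j<n. X (shiftZ (int j) \<omega>) = w j)"
        using PiE_arb[OF w] by (auto simp: path_def fun_eq_iff restrict_def)
      also have "\<dots> \<longleftrightarrow> (\<forall>j<n. shiftZ (int j) \<omega> \<in> \<alpha> (w j))"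
        using iff PiE_mem[OF w] by auto
      finally show "\<omega> \<in> space M \<inter> (\<Inter>j<n. shiftZ (int j) -` \<alpha> (w j)) \<longleftrightarrow> \<omega> \<in> {\<omega>. path X n \<omega> = w}"
        by auto
    qed
    then show ?thesis
      unfolding join_entropy_def Let_def
      by (subst entropy_eq_sum[OF simple_path[OF simple] _ rX]) (auto intro!: finite_PiE sum.cong)
  qed
  with simple X show thesis by (rule that)
qed

text \<open>In \<open>entropy_path_le\<close> the window m is fixed while n grows, so the 2m extra
  letters disappear after division by n. What remains is the prediction cost, which tends to 0 with
  d.\<close>

lemma entropy_path_limit_le:
  fixes X :: "(int \<Rightarrow> 'e) \<Rightarrow> nat"
  assumes h: "(\<lambda>n. ent (word n) / real n) \<longlonglongrightarrow> h"
    and X: "simple_function M X" and k: "\<And>\<omega>. X \<omega> < k"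
    and l: "(\<lambda>n. ent (path X (Suc n)) / real (Suc n)) \<longlonglongrightarrow> l"
  shows "l \<le> h"
proof -
  let ?\<kappa> = "\<lambda>d. - ln (1 - d) - d * ln (d / real k)"
  have "k > 0" using k gr0I not_less0 by metis
  have le: "l \<le> h + ?\<kappa> d" if d: "0 < d" "d < 1" for d
  proof -
    obtain m f where f: "local_fun m f" "prob {\<omega>. X \<omega> \<noteq> f \<omega>} < d"
      using approx_by_local_fun[OF X d(1)] by blast
    have "(\<lambda>n. ent (word (n + Suc (2 * m))) / real (n + Suc (2 * m))) \<longlonglongrightarrow> h"
      using h by (rule LIMSEQ_ignore_initial_segment)
    moreover have "(\<lambda>n. real (n + Suc (2 * m)) / real (Suc n)) \<longlonglongrightarrow> 1" by real_asymp
    ultimately have "(\<lambda>n. ent (word (n + Suc (2 * m))) / real (n + Suc (2 * m)) * (real (n + Suc (2 * m)) / real (Suc n)) + ?\<kappa> d)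
        \<longlonglongrightarrow> h * 1 + ?\<kappa> d"
      by (intro tendsto_add tendsto_mult tendsto_const)
    then have "(\<lambda>n. ent (word (Suc n + 2 * m)) / real (Suc n) + ?\<kappa> d) \<longlonglongrightarrow> h + ?\<kappa> d"
      by (simp del: of_nat_Suc of_nat_add)
    moreover have "ent (path X (Suc n)) / real (Suc n) \<le> ent (word (Suc n + 2 * m)) / real (Suc n) + ?\<kappa> d" for n
      using divide_right_mono[OF entropy_path_le[OF X k f(1) d less_imp_le[OF f(2)], of "Suc n"], of "real (Suc n)"]
      by (simp add: add_divide_distrib del: of_nat_Suc)
    ultimately show ?thesis by (intro LIMSEQ_le[OF l]) auto
  qed
  have "((\<lambda>d. h + ?\<kappa> d) \<longlongrightarrow> h) (at_right 0)"
    using \<open>k > 0\<close> by real_asymp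
  moreover have "\<forall>\<^sub>F d in at_right 0. l \<le> h + ?\<kappa> d"
    by (rule eventually_at_rightI[of 0 1]) (use le in auto)
  ultimately show "l \<le> h" by (rule tendsto_lowerbound) simp
qed

text \<open>The word and its relabelled path are functions of each other, so data processing applies
  both ways. The labelling \<open>g\<close> is the identity for convergence and a numbering of the
  alphabet for partitions.\<close>

lemma ent_path_coordinate:
  assumes g: "inj g" shows "ent (path (\<lambda>\<omega>. g (\<omega> 0)) n) = ent (word n)"
proof (rule antisym)
  show "ent (path (\<lambda>\<omega>. g (\<omega> 0)) n) \<le> ent (word n)"
    by (rule entropy_function_le[OF simple_word, of _ "\<lambda>w. \<lambda>j\<in>{..<n}. g (w (int j))"])
      (auto simp: path_def word_def shiftZ_def intro!: restrict_ext)
  have S: "simple_function M (\<lambda>\<omega>. g (\<omega> 0))"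
    by (rule local_fun_simple[of 0]) (simp add: local_fun_def agree_def)
  show "ent (word n) \<le> ent (path (\<lambda>\<omega>. g (\<omega> 0)) n)"
    by (rule entropy_function_le[OF simple_path[OF S], of _ "\<lambda>p. \<lambda>j\<in>{0..<int n}. inv g (p (nat j))"])
      (auto simp: path_def word_def shiftZ_def g intro!: restrict_ext)
qed

lemma ent_word_convergent: "convergent (\<lambda>n. ent (word (Suc n)) / real (Suc n))"
proof -
  have "simple_function M (\<lambda>\<omega>. \<omega> 0)"
    by (rule local_fun_simple[of 0]) (simp add: local_fun_def agree_def)
  from entropy_path_convergent[OF this] show ?thesis
    using ent_path_coordinate[OF inj_on_id2] by simp
qed

text \<open>The supremum is a maximum: the partition by the letter at 0 has entropy
  \<open>h\<close>, and \<open>entropy_path_limit_le\<close> bounds all others. The bijection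
  \<open>e\<close> numbers the letters, since partitions are indexed by \<open>nat\<close>.\<close>

theorem ks_entropy_eq:
  assumes h: "(\<lambda>n. ent (word n) / real n) \<longlonglongrightarrow> h"
  shows "ks_entropy M = h"
  unfolding ks_entropy_def
proof (rule cSup_eq_maximum)
  have h': "(\<lambda>n. ent (word (Suc n)) / real (Suc n)) \<longlonglongrightarrow> h"
    using h by (rule LIMSEQ_Suc)
  obtain e where e: "bij_betw e {..<CARD('e)} (UNIV :: 'e set)"
    using ex_bij_betw_nat_finite[of "UNIV :: 'e set"] by (auto simp: lessThan_atLeast0)
  define \<alpha> where "\<alpha> i = {\<omega> :: int \<Rightarrow> 'e. \<omega> 0 = e i}" for i
  have \<alpha>: "is_fin_partition M \<alpha> CARD('e)"
    unfolding is_fin_partition_def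
  proof (intro conjI allI impI)
    show "\<alpha> i \<in> sets M" for i
      by (rule local_set_measurable_M[of 0]) (simp add: local_fun_def agree_def \<alpha>_def)
    show "\<alpha> i \<inter> \<alpha> j = {}" if "i < CARD('e)" "j < CARD('e)" "i \<noteq> j" for i j
      using that bij_betw_imp_inj_on[OF e] by (auto simp: \<alpha>_def inj_on_def)
    have "\<exists>i<CARD('e). \<omega> 0 = e i" for \<omega> :: "int \<Rightarrow> 'e"
      using bij_betw_imp_surj_on[OF e] by (metis UNIV_I imageE lessThan_iff)
    then show "(\<Union>i<CARD('e). \<alpha> i) = space M" by (auto simp: \<alpha>_def)
  qed
  from partition_path[OF \<alpha>] obtain X where X: "simple_function M X" "\<And>\<omega>. X \<omega> < CARD('e)"
    "\<And>\<omega>. \<omega> \<in> \<alpha> (X \<omega>)" "\<And>n. join_entropy M \<alpha> CARD('e) n = ent (path X n)" by blast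
  have eX: "e (X \<omega>) = \<omega> 0" for \<omega> using X(3)[of \<omega>] by (simp add: \<alpha>_def)
  have Xe: "X \<omega> = inv_into {..<CARD('e)} e (\<omega> 0)" for \<omega>
    using inv_into_f_f[OF bij_betw_imp_inj_on[OF e], of "X \<omega>"] X(2) eX by simp
  have "inj (inv_into {..<CARD('e)} e)"
    using bij_betw_imp_inj_on[OF bij_betw_inv_into[OF e]] .
  then have "ent (path X n) = ent (word n)" for n
    using ent_path_coordinate[of "inv_into {..<CARD('e)} e" n] by (simp add: Xe[abs_def])
  then have "partition_entropy M \<alpha> CARD('e) = h"
    unfolding partition_entropy_def X(4) by (intro limI) (use h' in simp)
  then show "h \<in> {partition_entropy M \<alpha> k |\<alpha> k. is_fin_partition M \<alpha> k}"
    using \<alpha> by blast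
next
  fix x assume "x \<in> {partition_entropy M \<alpha> k |\<alpha> k. is_fin_partition M \<alpha> k}"
  then obtain \<alpha> k where x: "x = partition_entropy M \<alpha> k" and \<alpha>: "is_fin_partition M \<alpha> k" by blast
  from partition_path[OF \<alpha>] obtain X where X: "simple_function M X" "\<And>\<omega>. X \<omega> < k"
    "\<And>n. join_entropy M \<alpha> k n = ent (path X n)" by metis
  have "(\<lambda>n. ent (path X (Suc n)) / real (Suc n)) \<longlonglongrightarrow> x"
    using entropy_path_convergent[OF X(1)] unfolding x partition_entropy_def X(3)
    by (simp add: convergent_LIMSEQ_iff)
  then show "x \<le> h" by (rule entropy_path_limit_le[OF h X(1,2)])
qed

end

section \<open>Gibbs measures and their potential\<close>

lemma sum_local_configs_singleton:
  "(\<Sum>\<xi>\<in>local_configs {i :: int}. G \<xi>) = (\<Sum>b\<in>(UNIV :: 'e set). G (restrict (\<lambda>_. b) {i}))"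
proof (rule sum.reindex_bij_witness[of _ "\<lambda>b. restrict (\<lambda>_. b) {i}" "\<lambda>\<xi>. \<xi> i"])
  fix \<xi> :: "int \<Rightarrow> 'e" assume "\<xi> \<in> local_configs {i}"
  then show "restrict (\<lambda>_. \<xi> i) {i} = \<xi>"
    by (intro extensionalityI[OF restrict_extensional]) (auto simp: PiE_def)
  then show "G (restrict (\<lambda>_. \<xi> i) {i}) = G \<xi>" by simp
qed auto

lemma restrict_glue: "\<xi> \<in> local_configs \<Lambda> \<Longrightarrow> restrict (glue \<Lambda> \<xi> \<omega>) \<Lambda> = \<xi>"
  by (rule extensionalityI[OF restrict_extensional]) (auto simp: PiE_def glue_def)

lemma restrict_singleton: "restrict \<eta> {i} = restrict (\<lambda>_. \<eta> i) {i}"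
  by (rule restrict_ext) simp

lemma glue_singleton: "glue {i} (restrict (\<lambda>_. b) {i}) \<omega> = fun_upd \<omega> i b"
  by (rule ext) (simp add: glue_def)

lemma cylinder_local:
  assumes "finite (\<Lambda> :: int set)"
  shows "\<exists>m. local_fun m (\<lambda>\<omega>. \<forall>k\<in>\<Lambda>. \<omega> k = w k)"
proof -
  obtain m where "\<forall>k\<in>\<Lambda>. \<bar>k\<bar> \<le> int m" using finite_int_set_bounded[OF assms] by blast
  then show ?thesis by (intro exI[of _ m]) (simp add: local_fun_def agree_def)
qed

text \<open>\<open>t\<close> is the reference letter: it fills windows and the right half-line, and
  energies are measured relative to it.\<close>

locale gibbs_measure = stationary M for M :: "(int \<Rightarrow> 'e::finite) measure" +
  fixes \<gamma> :: "int set \<Rightarrow> (int \<Rightarrow> 'e) \<Rightarrow> (int \<Rightarrow> 'e) \<Rightarrow> real" and t :: 'e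
  assumes gibbsian: "gibbsian \<gamma>" and gibbs_for: "gibbs_for \<gamma> M"
begin

section \<open>Positivity and continuity of the kernels\<close>

lemmas spec_axioms = gibbsian[unfolded gibbsian_def is_specification_def, THEN conjunct1]

lemma gamma_sum: "finite \<Lambda> \<Longrightarrow> (\<Sum>\<xi>\<in>local_configs \<Lambda>. \<gamma> \<Lambda> \<xi> \<omega>) = 1"
  using spec_axioms[THEN conjunct2, THEN conjunct1] by blast

lemma gamma_local:
  "finite \<Lambda> \<Longrightarrow> \<xi> \<in> local_configs \<Lambda> \<Longrightarrow> (\<And>k. k \<notin> \<Lambda> \<Longrightarrow> \<omega> k = \<omega>' k) \<Longrightarrow> \<gamma> \<Lambda> \<xi> \<omega> = \<gamma> \<Lambda> \<xi> \<omega>'"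
  using spec_axioms[THEN conjunct2, THEN conjunct2, THEN conjunct1] by blast

lemma gamma_consistent:
  "finite \<Lambda> \<Longrightarrow> \<Delta> \<subseteq> \<Lambda> \<Longrightarrow>
    (\<Sum>\<xi>\<in>local_configs \<Lambda>. \<gamma> \<Lambda> \<xi> \<omega> * spec_expect \<gamma> \<Delta> f (glue \<Lambda> \<xi> \<omega>)) = spec_expect \<gamma> \<Lambda> f \<omega>"
  using spec_axioms[THEN conjunct2, THEN conjunct2, THEN conjunct2] by blast

text \<open>Non-nullness and continuity are assumed only on the diagonal, where the inner word is
  that of the configuration. As the kernel sees only the outside, gluing the word in brings any pair
  to the diagonal.\<close>

lemma gamma_glue:
  assumes "finite \<Lambda>" "\<xi> \<in> local_configs \<Lambda>"
  shows "\<gamma> \<Lambda> \<xi> \<omega> = \<gamma> \<Lambda> (restrict (glue \<Lambda> \<xi> \<omega>) \<Lambda>) (glue \<Lambda> \<xi> \<omega>)"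
  unfolding restrict_glue[OF assms(2)] by (rule gamma_local[OF assms]) (simp add: glue_def)

lemma gamma_lower_bound:
  assumes "finite \<Lambda>" "\<xi> \<in> local_configs \<Lambda>"
  shows "\<exists>c>0. \<forall>\<omega>. \<gamma> \<Lambda> \<xi> \<omega> \<ge> c"
proof -
  obtain c where "c > 0" "\<And>\<omega>. \<gamma> \<Lambda> (restrict \<omega> \<Lambda>) \<omega> \<ge> c"
    using gibbsian assms(1) unfolding gibbsian_def by blast
  then show ?thesis using gamma_glue[OF assms] by metis
qed

lemma gamma_pos: "finite \<Lambda> \<Longrightarrow> \<xi> \<in> local_configs \<Lambda> \<Longrightarrow> \<gamma> \<Lambda> \<xi> \<omega> > 0"
  using gamma_lower_bound[of \<Lambda> \<xi>] by (auto intro: less_le_trans)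

lemma ucont_gamma:
  assumes "finite \<Lambda>" "\<xi> \<in> local_configs \<Lambda>" shows "ucont (\<gamma> \<Lambda> \<xi>)"
proof -
  have "ucont (\<lambda>\<omega>. \<gamma> \<Lambda> (restrict \<omega> \<Lambda>) \<omega>)"
    using gibbsian assms(1) unfolding gibbsian_def continuous_iff_ucont by blast
  from ucont_glue[OF this, of \<Lambda> \<xi>] show ?thesis
    unfolding gamma_glue[OF assms, symmetric] .
qed

section \<open>The DLR equations and full support\<close>

lemma dlr: "finite \<Lambda> \<Longrightarrow> ucont f \<Longrightarrow> (\<integral>\<omega>. spec_expect \<gamma> \<Lambda> f \<omega> \<partial>M) = (\<integral>\<omega>. f \<omega> \<partial>M)"
  using gibbs_for unfolding gibbs_for_def continuous_iff_ucont by blast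

lemma ucont_measurable_M: "ucont f \<Longrightarrow> f \<in> borel_measurable M"
  using ucont_measurable by (simp cong: measurable_cong_sets add: measurable_cong_sets[OF sets_M refl])

lemma ucont_integrable:
  assumes "ucont f" shows "integrable M f"
proof -
  obtain B where "\<And>\<omega>. \<bar>f \<omega>\<bar> \<le> B" using ucont_bounded[OF assms] by blast
  then show ?thesis
    by (intro integrable_const_bound[of _ B] ucont_measurable_M assms) simp
qed

lemma cylinder_sets: "finite \<Lambda> \<Longrightarrow> {\<omega>. \<forall>k\<in>\<Lambda>. \<omega> k = w k} \<in> sets M"
  unfolding sets_M by (rule measurable_cylinder)

text \<open>The indicator of a cylinder is local, hence continuous, hence a test function for DLR;
  averaged by the kernel it leaves only the term of \<open>w\<close>.\<close>

lemma prob_cylinder: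
  assumes "finite \<Lambda>" "w \<in> local_configs \<Lambda>"
  shows "prob {\<omega>. \<forall>k\<in>\<Lambda>. \<omega> k = w k} = (\<integral>\<omega>. \<gamma> \<Lambda> w \<omega> \<partial>M)"
proof -
  let ?C = "{\<omega>. \<forall>k\<in>\<Lambda>. \<omega> k = w k}"
  obtain m where "local_fun m (\<lambda>\<omega>. \<forall>k\<in>\<Lambda>. \<omega> k = w k)" using cylinder_local[OF assms(1)] by blast
  then have "local_fun m (indicat_real ?C)" by (simp add: local_fun_def indicator_def)
  then have u: "ucont (indicat_real ?C)" by (rule local_fun_ucont)
  have "spec_expect \<gamma> \<Lambda> (indicat_real ?C) \<omega> = \<gamma> \<Lambda> w \<omega>" for \<omega>
  proof -
    have "indicat_real ?C (glue \<Lambda> \<xi> \<omega>) = (if \<xi> = w then 1 else 0)" if "\<xi> \<in> local_configs \<Lambda>" for \<xi>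
    proof -
      have "(\<forall>k\<in>\<Lambda>. \<xi> k = w k) \<longleftrightarrow> \<xi> = w"
        using PiE_ext[OF that assms(2)] by blast
      then show ?thesis by (auto simp: indicator_def glue_def)
    qed
    then have "spec_expect \<gamma> \<Lambda> (indicat_real ?C) \<omega> = (\<Sum>\<xi>\<in>local_configs \<Lambda>. if \<xi> = w then \<gamma> \<Lambda> \<xi> \<omega> else 0)"
      unfolding spec_expect_def by (intro sum.cong) auto
    also have "\<dots> = \<gamma> \<Lambda> w \<omega>" using assms by (simp add: finite_PiE)
    finally show ?thesis .
  qed
  with dlr[OF assms(1) u] show ?thesis
    using cylinder_sets[OF assms(1), of w] by simp
qed

lemma prob_cylinder_pos:
  assumes "finite \<Lambda>" shows "prob {\<omega>. \<forall>k\<in>\<Lambda>. \<omega> k = w k} > 0"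
proof -
  have w: "restrict w \<Lambda> \<in> local_configs \<Lambda>" by simp
  obtain c where c: "c > 0" "\<And>\<omega>. \<gamma> \<Lambda> (restrict w \<Lambda>) \<omega> \<ge> c"
    using gamma_lower_bound[OF assms w] by blast
  have "c = (\<integral>\<omega>. c \<partial>M)" by simp
  also have "\<dots> \<le> (\<integral>\<omega>. \<gamma> \<Lambda> (restrict w \<Lambda>) \<omega> \<partial>M)"
    using c(2) by (intro integral_mono integrable_const ucont_integrable ucont_gamma assms w)
  also have "\<dots> = prob {\<omega>. \<forall>k\<in>\<Lambda>. \<omega> k = w k}"
    using prob_cylinder[OF assms w] by (simp cong: ball_cong)
  finally show ?thesis using c(1) by simp
qed

text \<open>Full support: if \<open>D\<close> were nonzero at a point, its square would be bounded
  below on a cylinder around that point, and this cylinder has positive probability.\<close>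

lemma ucont_zero:
  assumes D: "ucont D" and "(\<integral>\<omega>. D \<omega> * D \<omega> \<partial>M) = 0" shows "D \<omega> = 0"
proof (rule ccontr)
  assume nz: "D \<omega> \<noteq> 0"
  let ?e = "\<bar>D \<omega>\<bar> / 2"
  obtain m where m: "\<And>\<omega>'. agree m \<omega> \<omega>' \<Longrightarrow> \<bar>D \<omega> - D \<omega>'\<bar> < ?e"
    using ucontD[OF D, of ?e] nz by (metis half_gt_zero zero_less_abs_iff)
  let ?C = "{\<omega>'. \<forall>k\<in>{-int m..int m}. \<omega>' k = \<omega> k}"
  have C: "?C \<in> sets M" by (rule cylinder_sets) simp
  have "0 < ?e * ?e * prob ?C"
    using nz prob_cylinder_pos[of "{-int m..int m}" \<omega>] by (intro mult_pos_pos) auto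
  also have "\<dots> = (\<integral>\<omega>'. ?e * ?e * indicat_real ?C \<omega>' \<partial>M)" using C by simp
  also have "\<dots> \<le> (\<integral>\<omega>'. D \<omega>' * D \<omega>' \<partial>M)"
  proof (rule integral_mono)
    show "integrable M (\<lambda>\<omega>'. ?e * ?e * indicat_real ?C \<omega>')"
      using C by (intro integrable_mult_right integrable_real_indicator) (auto simp: emeasure_eq_measure)
    show "integrable M (\<lambda>\<omega>'. D \<omega>' * D \<omega>')" by (intro ucont_integrable ucont_mult D)
    fix \<omega>'
    show "?e * ?e * indicat_real ?C \<omega>' \<le> D \<omega>' * D \<omega>'"
    proof (cases "\<omega>' \<in> ?C")
      case True
      then have "agree m \<omega> \<omega>'" by (auto simp: agree_def abs_le_iff)
      then have "?e \<le> \<bar>D \<omega>'\<bar>" using m[of \<omega>'] by linarith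
      then have "?e * ?e \<le> \<bar>D \<omega>'\<bar> * \<bar>D \<omega>'\<bar>" by (intro mult_mono) auto
      then show ?thesis using True by simp
    qed simp
  qed
  finally show False using assms(2) by simp
qed

section \<open>Single-site kernels and their shift covariance\<close>

definition site :: "int \<Rightarrow> 'e \<Rightarrow> (int \<Rightarrow> 'e) \<Rightarrow> real" where
  "site i a \<omega> = \<gamma> {i} (restrict (\<lambda>_. a) {i}) \<omega>"

lemma site_pos: "site i a \<omega> > 0"
  unfolding site_def by (rule gamma_pos) auto

lemma ucont_site: "ucont (site i a)"
  unfolding site_def[abs_def] by (rule ucont_gamma) auto

lemma site_upd [simp]: "site i a (fun_upd \<omega> i b) = site i a \<omega>"
  unfolding site_def by (rule gamma_local) auto

text \<open>\<open>site i a\<close> is a version of the conditional probability of the letter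
  \<open>a\<close> at \<open>i\<close> given all other sites, so functions of the other sites factor
  out.\<close>

lemma site_dlr:
  assumes g: "ucont g" and ind: "\<And>\<omega> b. g (fun_upd \<omega> i b) = g \<omega>"
  shows "(\<integral>\<omega>. g \<omega> * site i a \<omega> \<partial>M) = (\<integral>\<omega>. g \<omega> * of_bool (\<omega> i = a) \<partial>M)"
proof -
  have "local_fun (nat \<bar>i\<bar>) (\<lambda>\<omega>. of_bool (\<omega> i = a) :: real)"
    by (simp add: local_fun_def agree_def)
  then have u: "ucont (\<lambda>\<omega>. g \<omega> * of_bool (\<omega> i = a))"
    by (intro ucont_mult g local_fun_ucont)
  have "spec_expect \<gamma> {i} (\<lambda>\<omega>. g \<omega> * of_bool (\<omega> i = a)) \<omega> = g \<omega> * site i a \<omega>" for \<omega>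
  proof -
    have "spec_expect \<gamma> {i} (\<lambda>\<omega>. g \<omega> * of_bool (\<omega> i = a)) \<omega>
        = (\<Sum>b\<in>UNIV. site i b \<omega> * (g \<omega> * of_bool (b = a)))"
      unfolding spec_expect_def sum_local_configs_singleton glue_singleton
      by (simp add: ind site_def)
    also have "\<dots> = (\<Sum>b\<in>UNIV. if b = a then site i b \<omega> * g \<omega> else 0)"
      by (intro sum.cong) auto
    finally show ?thesis by simp
  qed
  with dlr[OF _ u, of "{i}"] show ?thesis by simp
qed

lemma shiftZ_upd: "shiftZ i (fun_upd \<omega> j b) = fun_upd (shiftZ i \<omega>) (j - i) b"
  by (rule ext) (auto simp: shiftZ_def)

text \<open>
  The difference \<open>D\<close> of the two sides does not depend on site \<open>i\<close>, so it may serve as test function in both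
  DLR equations; this gives \<open>\<integral>D\<^sup>2 dM = 0\<close>.
\<close>

lemma site_shiftZ: "site i a \<omega> = site 0 a (shiftZ i \<omega>)"
proof -
  define D where "D \<omega> = site i a \<omega> - site 0 a (shiftZ i \<omega>)" for \<omega>
  have D: "ucont D" unfolding D_def[abs_def] by (intro ucont_diff ucont_site ucont_shiftZ)
  have ind: "D (fun_upd \<omega> i b) = D \<omega>" for \<omega> b
    by (simp add: D_def shiftZ_upd)
  have D': "ucont (\<lambda>\<omega>. D (shiftZ (-i) \<omega>))" by (intro ucont_shiftZ D)
  have 1: "(\<integral>\<omega>. D \<omega> * site i a \<omega> \<partial>M) = (\<integral>\<omega>. D \<omega> * of_bool (\<omega> i = a) \<partial>M)"
    by (rule site_dlr[OF D ind])
  have m1: "(\<lambda>\<omega>. D \<omega> * site 0 a (shiftZ i \<omega>)) \<in> borel_measurable M"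
    by (intro ucont_measurable_M ucont_mult D ucont_shiftZ ucont_site)
  have "local_fun (nat \<bar>i\<bar>) (\<lambda>\<omega>. of_bool (\<omega> i = a) :: real)"
    by (simp add: local_fun_def agree_def)
  then have m2: "(\<lambda>\<omega>. D \<omega> * of_bool (\<omega> i = a)) \<in> borel_measurable M"
    by (intro ucont_measurable_M ucont_mult D local_fun_ucont)
  \<comment> \<open>Invariance of \<open>M\<close> carries the integral to the origin, where DLR for
    site 0 applies, and then back to site \<open>i\<close>.\<close>
  have "(\<integral>\<omega>. D \<omega> * site 0 a (shiftZ i \<omega>) \<partial>M) = (\<integral>\<omega>. D (shiftZ (-i) \<omega>) * site 0 a \<omega> \<partial>M)"
    using integral_shiftZ[OF m1, of "-i"] by simp
  also have "\<dots> = (\<integral>\<omega>. D (shiftZ (-i) \<omega>) * of_bool (\<omega> 0 = a) \<partial>M)"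
    by (rule site_dlr[OF D']) (simp add: shiftZ_upd ind)
  also have "\<dots> = (\<integral>\<omega>. D \<omega> * of_bool (\<omega> i = a) \<partial>M)"
    using integral_shiftZ[OF m2, of "-i"] by (simp add: shiftZ_def)
  finally have 2: "(\<integral>\<omega>. D \<omega> * site 0 a (shiftZ i \<omega>) \<partial>M) = (\<integral>\<omega>. D \<omega> * of_bool (\<omega> i = a) \<partial>M)" .
  have "D \<omega> * D \<omega> = D \<omega> * site i a \<omega> - D \<omega> * site 0 a (shiftZ i \<omega>)" for \<omega>
    unfolding right_diff_distrib[symmetric] by (simp add: D_def)
  moreover have "(\<integral>\<omega>. D \<omega> * site i a \<omega> - D \<omega> * site 0 a (shiftZ i \<omega>) \<partial>M) = 0"
    using 1 2 by (subst Bochner_Integration.integral_diff)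
      (auto intro!: ucont_integrable ucont_mult D ucont_shiftZ ucont_site)
  ultimately have "(\<integral>\<omega>. D \<omega> * D \<omega> \<partial>M) = 0" by simp
  then have "D \<omega> = 0" by (rule ucont_zero[OF D])
  then show ?thesis by (simp add: D_def)
qed

text \<open>
  Consistency tested on the indicator of the single configuration \<open>\<eta>\<close>; the sum on the right does not
  depend on \<open>\<eta> i\<close>.
\<close>

lemma gamma_site:
  assumes "finite \<Lambda>" "i \<in> \<Lambda>"
  shows "\<gamma> \<Lambda> (restrict \<eta> \<Lambda>) \<eta>
    = (\<Sum>\<xi>\<in>local_configs \<Lambda>. \<gamma> \<Lambda> \<xi> \<eta> * of_bool (\<forall>k\<in>\<Lambda> - {i}. \<xi> k = \<eta> k)) * site i (\<eta> i) \<eta>"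
proof -
  \<comment> \<open>This indicator is discontinuous in general, but the consistency axiom ranges
    over all functions and involves finite sums only.\<close>
  let ?f = "\<lambda>\<omega>. of_bool (\<omega> = \<eta>) :: real"
  have "spec_expect \<gamma> \<Lambda> ?f \<eta> = (\<Sum>\<xi>\<in>local_configs \<Lambda>. if \<xi> = restrict \<eta> \<Lambda> then \<gamma> \<Lambda> \<xi> \<eta> else 0)"
    unfolding spec_expect_def
  proof (rule sum.cong[OF refl])
    fix \<xi> :: "int \<Rightarrow> 'e" assume \<xi>: "\<xi> \<in> local_configs \<Lambda>"
    have "glue \<Lambda> \<xi> \<eta> = \<eta> \<longleftrightarrow> \<xi> = restrict \<eta> \<Lambda>"
    proof
      show "\<xi> = restrict \<eta> \<Lambda>" if "glue \<Lambda> \<xi> \<eta> = \<eta>"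
        using restrict_glue[OF \<xi>, of \<eta>] that by simp
      show "glue \<Lambda> \<xi> \<eta> = \<eta>" if "\<xi> = restrict \<eta> \<Lambda>"
        unfolding that by (rule ext) (simp add: glue_def)
    qed
    then show "\<gamma> \<Lambda> \<xi> \<eta> * ?f (glue \<Lambda> \<xi> \<eta>) = (if \<xi> = restrict \<eta> \<Lambda> then \<gamma> \<Lambda> \<xi> \<eta> else 0)" by simp
  qed
  also have "\<dots> = \<gamma> \<Lambda> (restrict \<eta> \<Lambda>) \<eta>" using assms(1) by (simp add: finite_PiE)
  finally have 1: "spec_expect \<gamma> \<Lambda> ?f \<eta> = \<gamma> \<Lambda> (restrict \<eta> \<Lambda>) \<eta>" .
  have 2: "spec_expect \<gamma> {i} ?f (glue \<Lambda> \<xi> \<eta>) = of_bool (\<forall>k\<in>\<Lambda> - {i}. \<xi> k = \<eta> k) * site i (\<eta> i) \<eta>" for \<xi>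
  proof -
    define P where "P \<longleftrightarrow> (\<forall>k\<in>\<Lambda> - {i}. \<xi> k = \<eta> k)"
    have eq: "fun_upd (glue \<Lambda> \<xi> \<eta>) i b = \<eta> \<longleftrightarrow> b = \<eta> i \<and> P" for b
      using assms(2) by (auto simp: P_def glue_def fun_eq_iff)
    \<comment> \<open>Under \<open>P\<close> the two configurations differ at most at
      \<open>i\<close>, a site that \<open>site i\<close> does not see.\<close>
    have st: "site i (\<eta> i) (glue \<Lambda> \<xi> \<eta>) = site i (\<eta> i) \<eta>" if P
      using that site_upd[of i "\<eta> i" "glue \<Lambda> \<xi> \<eta>" "\<eta> i"] eq[of "\<eta> i"] by metis
    have "spec_expect \<gamma> {i} ?f (glue \<Lambda> \<xi> \<eta>)
        = (\<Sum>b\<in>UNIV. if b = \<eta> i then site i b (glue \<Lambda> \<xi> \<eta>) * of_bool P else 0)"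
      unfolding spec_expect_def sum_local_configs_singleton glue_singleton eq
      by (intro sum.cong) (auto simp: site_def)
    also have "\<dots> = of_bool P * site i (\<eta> i) \<eta>" using st by (cases P) simp_all
    finally show ?thesis unfolding P_def .
  qed
  have "{i} \<subseteq> \<Lambda>" using assms(2) by simp
  from gamma_consistent[OF assms(1) this, of \<eta> ?f] show ?thesis
    unfolding 1 2 by (simp add: sum_distrib_right mult.assoc)
qed

section \<open>Telescoping of log kernels and the potential\<close>

definition lngam :: "int set \<Rightarrow> (int \<Rightarrow> 'e) \<Rightarrow> real" where
  "lngam \<Lambda> \<eta> = ln (\<gamma> \<Lambda> (restrict \<eta> \<Lambda>) \<eta>)"

definition spin :: "(int \<Rightarrow> 'e) \<Rightarrow> real" where
  "spin \<eta> = ln (site 0 (\<eta> 0) \<eta>) - ln (site 0 t \<eta>)"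

text \<open>By \<open>gamma_site\<close> the kernel is a positive factor blind to site
  \<open>i\<close> times a single-site kernel. The factor cancels in the ratio, and
  \<open>site_shiftZ\<close> moves the rest to the origin.\<close>

lemma lngam_upd:
  assumes "finite \<Lambda>" "i \<in> \<Lambda>"
  shows "lngam \<Lambda> \<eta> - lngam \<Lambda> (fun_upd \<eta> i t) = spin (shiftZ i \<eta>)"
proof -
  define T where "T \<eta> = (\<Sum>\<xi>\<in>local_configs \<Lambda>. \<gamma> \<Lambda> \<xi> \<eta> * of_bool (\<forall>k\<in>\<Lambda> - {i}. \<xi> k = \<eta> k))" for \<eta>
  have T_upd: "T (fun_upd \<eta> i t) = T \<eta>"
    unfolding T_def using assms(2)
    by (intro sum.cong arg_cong2[of _ _ _ _ "(*)"] gamma_local assms(1)) auto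
  have eq: "\<gamma> \<Lambda> (restrict \<eta> \<Lambda>) \<eta> = T \<eta> * site i (\<eta> i) \<eta>" for \<eta>
    unfolding T_def by (rule gamma_site[OF assms])
  have "T \<eta> * site i (\<eta> i) \<eta> > 0"
    unfolding eq[symmetric] by (rule gamma_pos[OF assms(1)]) simp
  then have T: "T \<eta> > 0" using site_pos[of i "\<eta> i" \<eta>] by (simp add: zero_less_mult_iff)
  have "ln (T \<eta> * site i a \<eta>) = ln (T \<eta>) + ln (site 0 a (shiftZ i \<eta>))" for a
    using T site_pos[of i a \<eta>] by (simp add: ln_mult_pos flip: site_shiftZ)
  then show ?thesis
    unfolding lngam_def eq T_upd spin_def by (simp add: shiftZ_def)
qed

definition fill :: "int \<Rightarrow> int \<Rightarrow> (int \<Rightarrow> 'e) \<Rightarrow> int \<Rightarrow> 'e" where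
  "fill p q \<eta> = (\<lambda>k. if p \<le> k \<and> k < q then t else \<eta> k)"

text \<open>Letters are replaced by \<open>t\<close> from right to left. When site i is changed, the
  sites i + 1, ..., q - 1 already carry \<open>t\<close>; hence the argument
  \<open>fill (i + 1) q\<close>, and hence a potential with \<open>t\<close> to the right.\<close>

lemma telescope:
  assumes "finite \<Lambda>" "{q - int n..<q} \<subseteq> \<Lambda>"
  shows "lngam \<Lambda> \<eta> - lngam \<Lambda> (fill (q - int n) q \<eta>)
    = (\<Sum>i\<in>{q - int n..<q}. spin (shiftZ i (fill (i + 1) q \<eta>)))"
  using assms(2)
proof (induction n)
  case 0
  have "fill q q \<eta> = \<eta>" by (rule ext) (auto simp: fill_def)
  then show ?case by simp
next
  case (Suc n)
  let ?i = "q - int (Suc n)"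
  have set: "{?i..<q} = insert ?i {q - int n..<q}" by auto
  have "fill ?i q \<eta> = fun_upd (fill (q - int n) q \<eta>) ?i t"
    by (auto simp: fill_def fun_eq_iff)
  then have "lngam \<Lambda> (fill (q - int n) q \<eta>) - lngam \<Lambda> (fill ?i q \<eta>) = spin (shiftZ ?i (fill (?i + 1) q \<eta>))"
    using lngam_upd[OF assms(1), of ?i "fill (q - int n) q \<eta>"] Suc.prems set by simp
  moreover have "lngam \<Lambda> \<eta> - lngam \<Lambda> (fill (q - int n) q \<eta>)
      = (\<Sum>i\<in>{q - int n..<q}. spin (shiftZ i (fill (i + 1) q \<eta>)))"
    using Suc.prems set by (intro Suc.IH) auto
  ultimately show ?case unfolding set by simp
qed

lemma ucont_spin: "ucont spin"
proof -
  have "ucont (\<lambda>\<eta>. \<gamma> {0} (restrict \<eta> {0}) \<eta>)"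
    using gibbsian unfolding gibbsian_def continuous_iff_ucont by blast
  then have "ucont (\<lambda>\<eta>. site 0 (\<eta> 0) \<eta>)" unfolding site_def by (subst (asm) restrict_singleton)
  then show ?thesis
    unfolding spin_def[abs_def] by (intro ucont_diff ucont_ln ucont_site site_pos)
qed

definition potential :: "(int \<Rightarrow> 'e) \<Rightarrow> real" where
  "potential \<omega> = spin (\<lambda>k. if k \<le> 0 then \<omega> k else t)"

lemma ucont_potential: "ucont potential"
proof -
  have "potential = (\<lambda>\<omega>. spin (glue {0<..} (\<lambda>_. t) \<omega>))"
    unfolding potential_def[abs_def] by (intro ext arg_cong[of _ _ spin]) (auto simp: glue_def)
  then show ?thesis
    using ucont_glue[OF ucont_spin, of "{0<..}" "\<lambda>_. t"] by simp
qed

end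

section \<open>Extensibility and equilibrium\<close>

text \<open>Bounds on x, unlike bounds on ln x, survive averaging; this translates between the
  two.\<close>

lemma abs_ln_diff_le_iff:
  fixes x b c :: real
  assumes "x > 0" shows "\<bar>ln x - b\<bar> \<le> c \<longleftrightarrow> exp (b - c) \<le> x \<and> x \<le> exp (b + c)"
proof -
  have "exp (b - c) \<le> x \<longleftrightarrow> b - c \<le> ln x" using assms by (simp add: ln_ge_iff)
  moreover have "x \<le> exp (b + c) \<longleftrightarrow> ln x \<le> b + c"
    using exp_le_cancel_iff[of "ln x" "b + c"] assms by simp
  ultimately show ?thesis by linarith
qed

context gibbs_measure
begin

text \<open>If \<open>t\<close> already stands from \<open>q\<close> on, filling up to
  \<open>q\<close> produces \<open>t\<close> on the whole half-line right of i, and the telescoping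
  term is exactly a term of the Birkhoff sum.\<close>

lemma potential_shiftZ:
  assumes "i < q" "\<And>k. k \<le> i \<Longrightarrow> \<eta> k = \<omega> k" "\<And>k. q \<le> k \<Longrightarrow> \<eta> k = t"
  shows "potential (shiftZ i \<omega>) = spin (shiftZ i (fill (i + 1) q \<eta>))"
  unfolding potential_def
  by (rule arg_cong[of _ _ spin], rule ext) (use assms in \<open>auto simp: shiftZ_def fill_def\<close>)

lemma extensible_potential: "extensible potential"
  unfolding extensible_def
proof (intro allI)
  fix a b :: 'e
  \<comment> \<open>Putting \<open>t\<close> beyond n does not alter the potentials at sites up to
    n, and it makes the telescoping exact.\<close>
  define trunc where "trunc n \<omega> = (\<lambda>k. if k \<le> int n then \<omega> k else t)" for n and \<omega> :: "int \<Rightarrow> 'e"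
  have eq: "(\<Sum>i\<in>{-int n..int n}. potential (shiftZ i (fun_upd \<omega> 0 a)) - potential (shiftZ i (fun_upd \<omega> 0 b)))
      = spin (trunc n (fun_upd \<omega> 0 a)) - spin (trunc n (fun_upd \<omega> 0 b))" for n \<omega>
  proof -
    let ?\<Lambda> = "{-int n..int n}"
    \<comment> \<open>The window has 2n + 1 sites and right end q = n + 1, because
      \<open>telescope\<close> uses half-open intervals.\<close>
    have win: "{int n + 1 - int (2 * n + 1)..<int n + 1} = ?\<Lambda>" by auto
    have tel: "(\<Sum>i\<in>?\<Lambda>. potential (shiftZ i (fun_upd \<omega> 0 c)))
        = lngam ?\<Lambda> (trunc n (fun_upd \<omega> 0 c)) - lngam ?\<Lambda> (fill (-int n) (int n + 1) (trunc n (fun_upd \<omega> 0 c)))" for c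
    proof -
      have "(\<Sum>i\<in>?\<Lambda>. potential (shiftZ i (fun_upd \<omega> 0 c)))
          = (\<Sum>i\<in>?\<Lambda>. spin (shiftZ i (fill (i + 1) (int n + 1) (trunc n (fun_upd \<omega> 0 c)))))"
        by (intro sum.cong refl potential_shiftZ) (auto simp: trunc_def)
      then show ?thesis
        using telescope[of ?\<Lambda> "int n + 1" "2 * n + 1" "trunc n (fun_upd \<omega> 0 c)"] unfolding win by simp
    qed
    \<comment> \<open>Filling the window erases site 0, the only site where the two configurations
      can differ, so the far ends of both telescoping sums cancel.\<close>
    have fill: "fill (-int n) (int n + 1) (trunc n (fun_upd \<omega> 0 a)) = fill (-int n) (int n + 1) (trunc n (fun_upd \<omega> 0 b))"
      by (rule ext) (simp add: fill_def trunc_def)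
    have upd: "fun_upd (trunc n (fun_upd \<omega> 0 a)) 0 t = fun_upd (trunc n (fun_upd \<omega> 0 b)) 0 t"
      by (rule ext) (simp add: trunc_def)
    have "lngam ?\<Lambda> (trunc n (fun_upd \<omega> 0 c)) - lngam ?\<Lambda> (fun_upd (trunc n (fun_upd \<omega> 0 c)) 0 t)
        = spin (trunc n (fun_upd \<omega> 0 c))" for c
      using lngam_upd[of ?\<Lambda> 0 "trunc n (fun_upd \<omega> 0 c)"] by simp
    from this[of a] this[of b] show ?thesis
      unfolding sum_subtractf tel fill upd by linarith
  qed
  have "uniform_limit UNIV (\<lambda>n \<omega>. spin (trunc n (fun_upd \<omega> 0 a)) - spin (trunc n (fun_upd \<omega> 0 b)))
      (\<lambda>\<omega>. spin (fun_upd \<omega> 0 a) - spin (fun_upd \<omega> 0 b)) sequentially"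
    unfolding uniform_limit_sequentially_iff
  proof (intro allI impI)
    fix \<epsilon> :: real assume "\<epsilon> > 0"
    then obtain m where m: "\<And>\<omega> \<omega>'. agree m \<omega> \<omega>' \<Longrightarrow> \<bar>spin \<omega> - spin \<omega>'\<bar> < \<epsilon> / 2"
      using ucontD[OF ucont_spin, of "\<epsilon> / 2"] by auto
    have "dist (spin (trunc n (fun_upd \<omega> 0 a)) - spin (trunc n (fun_upd \<omega> 0 b)))
        (spin (fun_upd \<omega> 0 a) - spin (fun_upd \<omega> 0 b)) < \<epsilon>" if "n \<ge> m" for n \<omega>
    proof -
      have "agree m (trunc n \<omega>') \<omega>'" for \<omega>' :: "int \<Rightarrow> 'e"
        using that by (auto simp: agree_def trunc_def)
      from m[OF this[of "fun_upd \<omega> 0 a"]] m[OF this[of "fun_upd \<omega> 0 b"]] show ?thesis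
        unfolding dist_real_def by linarith
    qed
    then show "\<exists>N. \<forall>n\<ge>N. \<forall>\<omega>\<in>UNIV. dist (spin (trunc n (fun_upd \<omega> 0 a)) - spin (trunc n (fun_upd \<omega> 0 b)))
        (spin (fun_upd \<omega> 0 a) - spin (fun_upd \<omega> 0 b)) < \<epsilon>" by blast
  qed
  then show "uniformly_convergent_on UNIV (\<lambda>n \<omega>. \<Sum>i\<in>{-int n..int n}.
      potential (shiftZ i (fun_upd \<omega> 0 a)) - potential (shiftZ i (fun_upd \<omega> 0 b)))"
    unfolding eq uniformly_convergent_on_def by blast
qed

section \<open>Uniform estimates on words and passage to the limit\<close>

lemma birkhoff_sum_int: "birkhoff_sum \<phi> n \<omega> = (\<Sum>i\<in>{0..<int n}. \<phi> (shiftZ i \<omega>))"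
  unfolding birkhoff_sum_def
  by (rule sum.reindex_bij_witness[of _ nat int]) auto

text \<open>At distance at least m from both ends, the telescoping term and the potential evaluate
  \<open>spin\<close> at configurations that agree on [-m, m]. Only boundary sites can contribute
  more than \<epsilon>.\<close>

lemma birkhoff_sum_approx:
  assumes "\<epsilon> > 0"
  obtains K where "K \<ge> 0" "\<And>n \<eta> \<omega>. (\<And>k. 0 \<le> k \<Longrightarrow> k < int n \<Longrightarrow> \<eta> k = \<omega> k) \<Longrightarrow>
    \<bar>lngam {0..<int n} \<eta> - lngam {0..<int n} (fill 0 (int n) \<eta>) - birkhoff_sum potential n \<omega>\<bar> \<le> \<epsilon> * real n + K"
proof -
  obtain B where B: "B > 0" "\<And>\<omega>. \<bar>spin \<omega>\<bar> \<le> B" using ucont_bounded[OF ucont_spin] by blast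
  obtain m where m: "\<And>\<omega> \<omega>'. agree m \<omega> \<omega>' \<Longrightarrow> \<bar>spin \<omega> - spin \<omega>'\<bar> < \<epsilon>"
    using ucontD[OF ucont_spin assms] by blast
  show thesis
  \<comment> \<open>At most m sites at each end are exceptional, each with error at most 2B; the
    constant does not depend on n.\<close>
  proof (rule that[of "4 * B * real m"])
    show "4 * B * real m \<ge> 0" using B(1) by simp
    fix n and \<eta> \<omega> :: "int \<Rightarrow> 'e" assume ag: "\<And>k. 0 \<le> k \<Longrightarrow> k < int n \<Longrightarrow> \<eta> k = \<omega> k"
    let ?\<Lambda> = "{0..<int n}"
    let ?d = "\<lambda>i. spin (shiftZ i (fill (i + 1) (int n) \<eta>)) - potential (shiftZ i \<omega>)"
    have d: "\<bar>?d i\<bar> \<le> \<epsilon> + 2 * B * of_bool (i < int m) + 2 * B * of_bool (int n - int m \<le> i)"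
      if i: "i \<in> ?\<Lambda>" for i
    proof (cases "i < int m \<or> int n - int m \<le> i")
      case True
      have "\<bar>?d i\<bar> \<le> 2 * B"
        using B(2)[of "shiftZ i (fill (i + 1) (int n) \<eta>)"]
          B(2)[of "\<lambda>k. if k \<le> 0 then shiftZ i \<omega> k else t"] unfolding potential_def by linarith
      also have "\<dots> \<le> \<epsilon> + 2 * B * of_bool (i < int m) + 2 * B * of_bool (int n - int m \<le> i)"
        using True B(1) assms by auto
      finally show ?thesis .
    next
      case False
      then have "agree m (shiftZ i (fill (i + 1) (int n) \<eta>)) (\<lambda>k. if k \<le> 0 then shiftZ i \<omega> k else t)"
        using i by (auto simp: agree_def shiftZ_def fill_def ag)
      from m[OF this] show ?thesis using False unfolding potential_def by simp
    qed
    have c1: "(\<Sum>i\<in>?\<Lambda>. of_bool (i < int m)) \<le> real m"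
    proof -
      have "(\<Sum>i\<in>?\<Lambda>. of_bool (i < int m)) = real (card (?\<Lambda> \<inter> {i. i < int m}))"
        by (subst sum_of_bool_eq) auto
      also have "\<dots> \<le> real (card {0..<int m})" by (intro of_nat_mono card_mono) auto
      finally show ?thesis by simp
    qed
    have c2: "(\<Sum>i\<in>?\<Lambda>. of_bool (int n - int m \<le> i)) \<le> real m"
    proof -
      have "(\<Sum>i\<in>?\<Lambda>. of_bool (int n - int m \<le> i)) = real (card (?\<Lambda> \<inter> {i. int n - int m \<le> i}))"
        by (subst sum_of_bool_eq) auto
      also have "\<dots> \<le> real (card {int n - int m..<int n})" by (intro of_nat_mono card_mono) auto
      finally show ?thesis by simp
    qed
    have eq: "lngam ?\<Lambda> \<eta> - lngam ?\<Lambda> (fill 0 (int n) \<eta>) - birkhoff_sum potential n \<omega> = (\<Sum>i\<in>?\<Lambda>. ?d i)"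
      using telescope[of ?\<Lambda> "int n" n \<eta>] by (simp add: birkhoff_sum_int sum_subtractf)
    have "\<bar>\<Sum>i\<in>?\<Lambda>. ?d i\<bar> \<le> (\<Sum>i\<in>?\<Lambda>. \<bar>?d i\<bar>)" by (rule sum_abs)
    also have "\<dots> \<le> (\<Sum>i\<in>?\<Lambda>. \<epsilon> + 2 * B * of_bool (i < int m) + 2 * B * of_bool (int n - int m \<le> i))"
      by (rule sum_mono) (rule d)
    also have "\<dots> = \<epsilon> * real n + 2 * B * (\<Sum>i\<in>?\<Lambda>. of_bool (i < int m)) + 2 * B * (\<Sum>i\<in>?\<Lambda>. of_bool (int n - int m \<le> i))"
      by (simp add: sum.distrib sum_distrib_left)
    also have "\<dots> \<le> \<epsilon> * real n + 2 * B * real m + 2 * B * real m"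
      using B(1) assms by (intro add_mono mult_left_mono c1 c2) auto
    finally show "\<bar>lngam ?\<Lambda> \<eta> - lngam ?\<Lambda> (fill 0 (int n) \<eta>) - birkhoff_sum potential n \<omega>\<bar> \<le> \<epsilon> * real n + 4 * B * real m"
      unfolding eq by simp
  qed
qed

text \<open>Normalisation fixes the weight of the all-\<open>t\<close> word as 1/R, where R sums the
  relative weights exp(\<rho> v). These are Birkhoff weights up to a factor exp(d), so R is the
  partition function up to the same factor. The two errors add to 2d, within the stated 4d.\<close>

lemma ln_gamma_approx:
  assumes approx: "\<And>\<eta> \<omega>. (\<And>k. 0 \<le> k \<Longrightarrow> k < int n \<Longrightarrow> \<eta> k = \<omega> k) \<Longrightarrow>
      \<bar>lngam {0..<int n} \<eta> - lngam {0..<int n} (fill 0 (int n) \<eta>) - birkhoff_sum potential n \<omega>\<bar> \<le> d"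
    and w: "w \<in> local_configs {0..<int n}"
    and \<omega>': "\<And>k. 0 \<le> k \<Longrightarrow> k < int n \<Longrightarrow> \<omega>' k = w k"
  shows "\<bar>ln (\<gamma> {0..<int n} w \<omega>) + ln (partition_fn potential n) - birkhoff_sum potential n \<omega>'\<bar> \<le> 4 * d"
proof -
  let ?\<Lambda> = "{0..<int n}"
  let ?S = "local_configs ?\<Lambda> :: (int \<Rightarrow> 'e) set"
  let ?\<theta> = "restrict (\<lambda>_. t) ?\<Lambda>"
  define G where "G v = Sup {birkhoff_sum potential n \<omega> |\<omega>. \<forall>k\<in>?\<Lambda>. \<omega> k = v k}" for v
  define \<rho> where "\<rho> v = ln (\<gamma> ?\<Lambda> v \<omega>) - ln (\<gamma> ?\<Lambda> ?\<theta> \<omega>)" for v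
  have pos: "\<gamma> ?\<Lambda> v \<omega> > 0" if "v \<in> ?S" for v using gamma_pos[OF _ that] by simp
  have \<theta>: "?\<theta> \<in> ?S" by simp
  have rho: "\<bar>\<rho> v - birkhoff_sum potential n \<zeta>\<bar> \<le> d"
    if v: "v \<in> ?S" and \<zeta>: "\<And>k. 0 \<le> k \<Longrightarrow> k < int n \<Longrightarrow> \<zeta> k = v k" for v \<zeta>
  proof -
    have "fill 0 (int n) (glue ?\<Lambda> v \<omega>) = glue ?\<Lambda> ?\<theta> \<omega>"
      by (rule ext) (auto simp: fill_def glue_def)
    then have "\<rho> v = lngam ?\<Lambda> (glue ?\<Lambda> v \<omega>) - lngam ?\<Lambda> (fill 0 (int n) (glue ?\<Lambda> v \<omega>))"
      unfolding \<rho>_def lngam_def using gamma_glue[OF _ v, of \<omega>] gamma_glue[OF _ \<theta>, of \<omega>] by simp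
    then show ?thesis using approx[of "glue ?\<Lambda> v \<omega>" \<zeta>] \<zeta> by (simp add: glue_def)
  qed
  have G: "\<bar>\<rho> v - G v\<bar> \<le> d" if v: "v \<in> ?S" for v
  proof -
    let ?B = "{birkhoff_sum potential n \<omega> |\<omega>. \<forall>k\<in>?\<Lambda>. \<omega> k = v k}"
    have bnd: "x \<in> {\<rho> v - d..\<rho> v + d}" if "x \<in> ?B" for x
    proof -
      from that obtain \<zeta> where \<zeta>: "x = birkhoff_sum potential n \<zeta>" "\<forall>k\<in>?\<Lambda>. \<zeta> k = v k" by blast
      then have "\<bar>\<rho> v - x\<bar> \<le> d" using rho[OF v, of \<zeta>] by simp
      then show ?thesis unfolding atLeastAtMost_iff by linarith
    qed
    have ne: "birkhoff_sum potential n v \<in> ?B" by blast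
    have "G v \<le> \<rho> v + d" unfolding G_def using bnd ne by (intro cSup_least) auto
    moreover have "birkhoff_sum potential n v \<le> G v"
      unfolding G_def using bnd ne by (intro cSup_upper bdd_aboveI[of _ "\<rho> v + d"]) auto
    ultimately show ?thesis using bnd[OF ne] by (simp add: abs_le_iff)
  qed
  have Z: "partition_fn potential n = (\<Sum>v\<in>?S. exp (G v))"
    by (simp add: partition_fn_def G_def)
  have fin: "finite ?S" by (intro finite_PiE) auto
  have Z_pos: "partition_fn potential n > 0"
    unfolding Z using fin \<theta> by (intro sum_pos) auto
  have "1 = (\<Sum>v\<in>?S. \<gamma> ?\<Lambda> v \<omega>)" using gamma_sum[of ?\<Lambda> \<omega>] by simp
  also have "\<dots> = (\<Sum>v\<in>?S. \<gamma> ?\<Lambda> ?\<theta> \<omega> * exp (\<rho> v))"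
  proof (rule sum.cong[OF refl])
    show "\<gamma> ?\<Lambda> v \<omega> = \<gamma> ?\<Lambda> ?\<theta> \<omega> * exp (\<rho> v)" if "v \<in> ?S" for v
      using pos[OF \<theta>] pos[OF that] by (simp add: \<rho>_def exp_diff)
  qed
  also have "\<dots> = \<gamma> ?\<Lambda> ?\<theta> \<omega> * (\<Sum>v\<in>?S. exp (\<rho> v))"
    by (simp add: sum_distrib_left)
  finally have one: "\<gamma> ?\<Lambda> ?\<theta> \<omega> * (\<Sum>v\<in>?S. exp (\<rho> v)) = 1" by simp
  let ?R = "\<Sum>v\<in>?S. exp (\<rho> v)"
  have R_pos: "?R > 0" using fin \<theta> by (intro sum_pos) auto
  have lnR: "ln (\<gamma> ?\<Lambda> ?\<theta> \<omega>) = - ln ?R"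
    using one pos[OF \<theta>] R_pos by (metis add_eq_0_iff2 ln_mult_pos ln_one)
  have "?R \<le> (\<Sum>v\<in>?S. exp (G v + d))"
    using G by (intro sum_mono) (force simp: abs_le_iff)
  also have "\<dots> = partition_fn potential n * exp d"
    by (simp add: Z exp_add sum_distrib_right)
  finally have up: "ln ?R \<le> ln (partition_fn potential n) + d"
    using R_pos Z_pos by (metis exp_gt_zero ln_exp ln_le_cancel_iff ln_mult_pos mult_pos_pos)
  have "partition_fn potential n \<le> (\<Sum>v\<in>?S. exp (\<rho> v + d))"
    unfolding Z using G by (intro sum_mono) (force simp: abs_le_iff)
  also have "\<dots> = ?R * exp d"
    by (simp add: exp_add sum_distrib_right)
  finally have lo: "ln (partition_fn potential n) \<le> ln ?R + d"
    using R_pos Z_pos by (metis exp_gt_zero ln_exp ln_le_cancel_iff ln_mult_pos mult_pos_pos)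
  have "\<bar>\<rho> w - birkhoff_sum potential n \<omega>'\<bar> \<le> d" by (rule rho[OF w \<omega>'])
  then show ?thesis
    using up lo lnR unfolding \<rho>_def abs_le_iff by linarith
qed

text \<open>The probability of a word averages its kernel over the boundary condition, and the
  bounds of \<open>ln_gamma_approx\<close> are uniform in that condition. Integrating the resulting
  log estimate gives entropy, partition function and mean potential at once.\<close>

lemma entropy_pressure_approx:
  assumes approx: "\<And>\<eta> \<omega>. (\<And>k. 0 \<le> k \<Longrightarrow> k < int n \<Longrightarrow> \<eta> k = \<omega> k) \<Longrightarrow>
      \<bar>lngam {0..<int n} \<eta> - lngam {0..<int n} (fill 0 (int n) \<eta>) - birkhoff_sum potential n \<omega>\<bar> \<le> d"
  shows "\<bar>ent (word n) - ln (partition_fn potential n) + real n * (\<integral>\<omega>. potential \<omega> \<partial>M)\<bar> \<le> 4 * d"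
proof -
  let ?\<Lambda> = "{0..<int n}"
  let ?S = "local_configs ?\<Lambda> :: (int \<Rightarrow> 'e) set"
  let ?Z = "ln (partition_fn potential n)"
  let ?p = "\<lambda>w. prob {\<omega>. word n \<omega> = w}"
  have fin: "finite ?S" by (intro finite_PiE) auto
  have p: "\<bar>ln (?p w) + ?Z - birkhoff_sum potential n \<omega>'\<bar> \<le> 4 * d" if w: "w = word n \<omega>'" for w \<omega>'
  proof -
    have wS: "w \<in> ?S" unfolding w using range_word[of n] by blast
    have "{\<omega>. word n \<omega> = w} = {\<omega>. \<forall>k\<in>?\<Lambda>. \<omega> k = w k}"
      using PiE_ext[OF _ wS] range_word[of n] by (fastforce simp: word_def w)
    then have eq: "?p w = (\<integral>\<omega>. \<gamma> ?\<Lambda> w \<omega> \<partial>M)" using prob_cylinder[OF _ wS] by simp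
    let ?b = "birkhoff_sum potential n \<omega>' - ?Z"
    have bnd: "\<bar>ln (\<gamma> ?\<Lambda> w \<omega>) - ?b\<bar> \<le> 4 * d" for \<omega>
      using ln_gamma_approx[OF approx wS, of \<omega>' \<omega>] by (simp add: w word_def algebra_simps)
    have pos: "\<gamma> ?\<Lambda> w \<omega> > 0" for \<omega> using gamma_pos[OF _ wS] by simp
    have bounds: "exp (?b - 4 * d) \<le> \<gamma> ?\<Lambda> w \<omega>" "\<gamma> ?\<Lambda> w \<omega> \<le> exp (?b + 4 * d)" for \<omega>
      using bnd[of \<omega>] abs_ln_diff_le_iff[OF pos[of \<omega>], of ?b "4 * d"] by blast+
    have int: "integrable M (\<gamma> ?\<Lambda> w)" by (intro ucont_integrable ucont_gamma wS) simp
    have "(\<integral>\<omega>. exp (?b - 4 * d) \<partial>M) \<le> ?p w"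
      unfolding eq by (intro integral_mono int bounds) simp
    moreover have "?p w \<le> (\<integral>\<omega>. exp (?b + 4 * d) \<partial>M)"
      unfolding eq by (intro integral_mono int bounds) simp
    ultimately have "exp (?b - 4 * d) \<le> ?p w" "?p w \<le> exp (?b + 4 * d)" by simp_all
    moreover from this(1) have "?p w > 0" by (rule less_le_trans[OF exp_gt_zero])
    ultimately have "\<bar>ln (?p w) - ?b\<bar> \<le> 4 * d" using abs_ln_diff_le_iff by blast
    then show ?thesis by (simp add: algebra_simps)
  qed
  let ?f = "\<lambda>\<omega>. ln (?p (word n \<omega>))"
  have intf: "integrable M ?f" and entf: "ent (word n) = - (\<integral>\<omega>. ?f \<omega> \<partial>M)"
    using integral_simple[OF simple_word fin range_word, of "\<lambda>w. ln (?p w)"]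
      entropy_eq_sum[OF simple_word fin range_word] by simp_all
  have intp: "integrable M (\<lambda>\<omega>. potential (shiftZ i \<omega>))" for i
    by (intro ucont_integrable ucont_shiftZ ucont_potential)
  have intb: "integrable M (birkhoff_sum potential n)"
    unfolding birkhoff_sum_def[abs_def] using intp by simp
  have "(\<integral>\<omega>. birkhoff_sum potential n \<omega> \<partial>M) = (\<Sum>j<n. \<integral>\<omega>. potential (shiftZ (int j) \<omega>) \<partial>M)"
    unfolding birkhoff_sum_def using intp by (intro Bochner_Integration.integral_sum)
  also have "\<dots> = real n * (\<integral>\<omega>. potential \<omega> \<partial>M)"
    using integral_shiftZ[OF ucont_measurable_M[OF ucont_potential]] by simp
  finally have ib: "(\<integral>\<omega>. birkhoff_sum potential n \<omega> \<partial>M) = real n * (\<integral>\<omega>. potential \<omega> \<partial>M)" .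
  have "(\<integral>\<omega>. ?f \<omega> + ?Z - birkhoff_sum potential n \<omega> \<partial>M) = - ent (word n) + ?Z - real n * (\<integral>\<omega>. potential \<omega> \<partial>M)"
    using intf intb by (simp add: entf ib)
  moreover have "\<bar>\<integral>\<omega>. ?f \<omega> + ?Z - birkhoff_sum potential n \<omega> \<partial>M\<bar> \<le> 4 * d"
  proof -
    have int: "integrable M (\<lambda>\<omega>. ?f \<omega> + ?Z - birkhoff_sum potential n \<omega>)" using intf intb by auto
    have "\<bar>\<integral>\<omega>. ?f \<omega> + ?Z - birkhoff_sum potential n \<omega> \<partial>M\<bar> \<le> (\<integral>\<omega>. \<bar>?f \<omega> + ?Z - birkhoff_sum potential n \<omega>\<bar> \<partial>M)"
      by (rule integral_abs_bound)
    also have "\<dots> \<le> (\<integral>\<omega>. 4 * d \<partial>M)"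
      using int p by (intro integral_mono integrable_abs) auto
    finally show ?thesis by simp
  qed
  ultimately show ?thesis by (simp add: abs_le_iff)
qed

lemma equilibrium_potential: "ks_entropy M + (\<integral>\<omega>. potential \<omega> \<partial>M) = pressure potential"
proof -
  let ?I = "\<integral>\<omega>. potential \<omega> \<partial>M"
  obtain h where h': "(\<lambda>n. ent (word (Suc n)) / real (Suc n)) \<longlonglongrightarrow> h"
    using ent_word_convergent by (auto simp: convergent_def)
  then have h: "(\<lambda>n. ent (word n) / real n) \<longlonglongrightarrow> h" by (rule LIMSEQ_imp_Suc)
  let ?e = "\<lambda>n. (ent (word (Suc n)) - ln (partition_fn potential (Suc n)) + real (Suc n) * ?I) / real (Suc n)"
  have "?e \<longlonglongrightarrow> 0"
  proof (rule LIMSEQ_I)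
    fix r :: real assume "r > 0"
    then obtain K where K: "K \<ge> 0" "\<And>n \<eta> \<omega>. (\<And>k. 0 \<le> k \<Longrightarrow> k < int n \<Longrightarrow> \<eta> k = \<omega> k) \<Longrightarrow>
        \<bar>lngam {0..<int n} \<eta> - lngam {0..<int n} (fill 0 (int n) \<eta>) - birkhoff_sum potential n \<omega>\<bar> \<le> r / 8 * real n + K"
      using birkhoff_sum_approx[of "r / 8"] by auto
    \<comment> \<open>With \<epsilon> = r/8 the error 4(\<epsilon> k + K) is rk/2 + 4K; for k > N
      the constant part is below rk/2.\<close>
    obtain N :: nat where N: "8 * K / r < real N" using reals_Archimedean2 by blast
    have "norm (?e n - 0) < r" if "n \<ge> N" for n
    proof -
      have "\<bar>ent (word (Suc n)) - ln (partition_fn potential (Suc n)) + real (Suc n) * ?I\<bar>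
          \<le> 4 * (r / 8 * real (Suc n) + K)"
        by (rule entropy_pressure_approx, rule K(2))
      moreover have "8 * K < r * real (Suc n)"
      proof -
        have "8 * K < r * real N" using N \<open>r > 0\<close> by (simp add: field_simps)
        also have "\<dots> \<le> r * real (Suc n)" using that \<open>r > 0\<close> by (intro mult_left_mono) auto
        finally show ?thesis .
      qed
      moreover have "4 * (r / 8 * real (Suc n) + K) = r * real (Suc n) / 2 + 4 * K"
        by (simp del: of_nat_Suc)
      ultimately have "\<bar>ent (word (Suc n)) - ln (partition_fn potential (Suc n)) + real (Suc n) * ?I\<bar>
          < r * real (Suc n)" by linarith
      then show ?thesis by (simp add: abs_divide divide_less_eq del: of_nat_Suc)
    qed
    then show "\<exists>no. \<forall>n\<ge>no. norm (?e n - 0) < r" by blast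
  qed
  \<comment> \<open>The entropy limit is known to exist, so the vanishing error forces convergence
    of the logarithmic partition functions; the \<open>lim\<close> in \<open>pressure\<close> is
    therefore a genuine limit.\<close>
  with h' have "(\<lambda>n. ent (word (Suc n)) / real (Suc n) + ?I - ?e n) \<longlonglongrightarrow> h + ?I - 0"
    by (intro tendsto_intros)
  moreover have "ent (word (Suc n)) / real (Suc n) + ?I - ?e n = ln (partition_fn potential (Suc n)) / real (Suc n)" for n
    by (simp add: add_divide_distrib diff_divide_distrib del: of_nat_Suc)
  ultimately have "pressure potential = h + ?I"
    unfolding pressure_def by (intro limI) simp
  then show ?thesis using ks_entropy_eq[OF h] by simp
qed

end

theorem theoremB:
  fixes M :: "(int \<Rightarrow> 'e::finite) measure"
  assumes "shift_invariant_prob M"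
    and "\<exists>\<gamma>. gibbsian \<gamma> \<and> gibbs_for \<gamma> M"
  shows "\<exists>\<phi>. continuous_map Omega_top euclideanreal \<phi> \<and> extensible \<phi> \<and> equilibrium_state \<phi> M"
proof -
  from assms(2) obtain \<gamma> where \<gamma>: "gibbsian \<gamma>" "gibbs_for \<gamma> M" by blast
  have inv: "prob_space M" "sets M = sets Omega_M"
    "\<And>A. A \<in> sets M \<Longrightarrow> measure M (shift -` A \<inter> space M) = measure M A"
    using assms(1) by (auto simp: shift_invariant_prob_def)
  \<comment> \<open>\<open>undefined\<close> supplies the reference letter \<open>t\<close>.\<close>
  interpret gibbs_measure M \<gamma> undefined
    using inv \<gamma> by (intro gibbs_measure.intro stationary.intro stationary_axioms.intro gibbs_measure_axioms.intro)
  have "continuous_map Omega_top euclideanreal potential"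
    by (rule ucont_imp_continuous[OF ucont_potential])
  moreover have "equilibrium_state potential M"
    using assms(1) equilibrium_potential by (simp add: equilibrium_state_def)
  ultimately show ?thesis using extensible_potential by blast
qed

end
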